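(* Let $P,Q\in\mathbb Z$ be coprime with $P^2-4Q>0$, and let $U_0=0$, $U_1=1$, $U_{n+2}=PU_{n+1}-QU_n$ be a nondegenerate Lucas sequence with $U_n>0$ for $n\ge1$ and exponential growth. Let $Z_U(s)=\sum_{n\ge1}U_n^{-s}$ for $\operatorname{Re}s>0$, and let $$\mathcal R_U=\{\operatorname{Re}\rho: Z_U(\rho)=0,\ \operatorname{Re}\rho>0\}.$$ Fix an integer $N$ such that every $U_n$ with $n>N$ has a primitive prime divisor. With $m_N,M_N,\ell_N,R_N$ as defined in the context, $$\overline{\mathcal R_U}\cap(0,\infty)=\left\{\sigma>0:\ [m_N(\sigma),M_N(\sigma)]\cap[\ell_N(\sigma),R_N(\sigma)]\neq\varnothing\right\}.$$ Equivalently, the condition on $\sigma$ is: $m_N(\sigma)\le R_N(\sigma)$ and $\ell_N(\sigma)\le M_N(\sigma)$. In particular, for every such Lucas sequence the identity holds with $N=30$, so that the closure of the real parts of the zeros of $Z_U$ in the half-plane of absolute convergence is determined by a finite torus involving only $U_1,\dots,U_{30}$ and the tail data $\ell_{30}(\sigma)$, $R_{30}(\sigma)$.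
   Context: A Lucas sequence is nondegenerate if $Q\ne0$ and the ratio of the two roots of $x^2-Px+Q$ is not a root of unity. Exponential growth means $U_n\ge c\lambda^n$ for some $c>0$, $\lambda>1$ and all $n\ge1$. A primitive prime divisor of $U_n$ is a prime dividing $U_n$ that divides no earlier $U_j$, $1\le j<n$. (By the known theorem of Bilu, Hanrot and Voutier, every $U_n$ with $n>30$ has a primitive prime divisor, so $N=30$ is always admissible.) $\mathbb T=\{z\in\mathbb C:|z|=1\}$. Let $\mathcal P_N$ be the finite set of primes dividing $U_1\cdots U_N$, and let $v_p$ be the $p$-adic valuation. For $\omega=(\omega_p)_{p\in\mathcal P_N}\in\mathbb T^{\mathcal P_N}$ and $\sigma>0$ put $$C_N(\sigma;\omega)=\sum_{n=1}^N U_n^{-\sigma}\prod_{p\in\mathcal P_N}\omega_p^{v_p(U_n)},$$ $$m_N(\sigma)=\min_\omega|C_N(\sigma;\omega)|,\qquad M_N(\sigma)=\max_\omega|C_N(\sigma;\omega)|,$$ $$R_N(\sigma)=\sum_{n>N}U_n^{-\sigma},\qquad A_N(\sigma)=\max_{n>N}U_n^{-\sigma},\qquad \ell_N(\sigma)=\max\{2A_N(\sigma)-R_N(\sigma),0\}.$$ The overline denotes closure in $\mathbb R$. *)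

theory Defs
  imports "HOL-Analysis.Analysis" "HOL-Computational_Algebra.Computational_Algebra"
begin

text \<open>Throughout, \<open>U :: nat \<Rightarrow> int\<close> is the sequence; primes are positive primes of \<open>int\<close>.\<close>

definition nondegenerate :: "int \<Rightarrow> int \<Rightarrow> bool" where
  "nondegenerate P Q \<longleftrightarrow> Q \<noteq> 0 \<and>
     (\<forall>\<alpha> \<beta> :: complex.
        (\<forall>x. x ^ 2 - of_int P * x + of_int Q = (x - \<alpha>) * (x - \<beta>)) \<longrightarrow>
        (\<forall>k::nat. k > 0 \<longrightarrow> (\<alpha> / \<beta>) ^ k \<noteq> 1))"

definition exponential_growth :: "(nat \<Rightarrow> int) \<Rightarrow> bool" where
  "exponential_growth U \<longleftrightarrow>
     (\<exists>c l :: real. c > 0 \<and> l > 1 \<and> (\<forall>n\<ge>1. real_of_int (U n) \<ge> c * l ^ n))"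

definition has_primitive_prime_divisor :: "(nat \<Rightarrow> int) \<Rightarrow> nat \<Rightarrow> bool" where
  "has_primitive_prime_divisor U n \<longleftrightarrow>
     (\<exists>p. prime p \<and> p dvd U n \<and> (\<forall>j. 1 \<le> j \<and> j < n \<longrightarrow> \<not> p dvd U j))"

definition Z :: "(nat \<Rightarrow> int) \<Rightarrow> complex \<Rightarrow> complex" where
  "Z U s = (\<Sum>\<^sub>\<infinity>n\<in>{1..}. of_int (U n) powr (-s))"

definition zero_real_parts :: "(nat \<Rightarrow> int) \<Rightarrow> real set" where
  "zero_real_parts U = {Re \<rho> |\<rho>. Z U \<rho> = 0 \<and> Re \<rho> > 0}"

definition prime_set :: "(nat \<Rightarrow> int) \<Rightarrow> nat \<Rightarrow> int set" where
  "prime_set U N = {p. prime p \<and> p dvd (\<Prod>n=1..N. U n)}"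

definition torus :: "(nat \<Rightarrow> int) \<Rightarrow> nat \<Rightarrow> (int \<Rightarrow> complex) set" where
  "torus U N = (\<Pi>\<^sub>E p\<in>prime_set U N. {z. norm z = 1})"

definition C :: "(nat \<Rightarrow> int) \<Rightarrow> nat \<Rightarrow> real \<Rightarrow> (int \<Rightarrow> complex) \<Rightarrow> complex" where
  "C U N \<sigma> \<omega> = (\<Sum>n=1..N. of_real (of_int (U n) powr (-\<sigma>)) *
                           (\<Prod>p\<in>prime_set U N. \<omega> p ^ multiplicity p (U n)))"

definition m_min :: "(nat \<Rightarrow> int) \<Rightarrow> nat \<Rightarrow> real \<Rightarrow> real" where
  "m_min U N \<sigma> = (LEAST r. \<exists>\<omega>\<in>torus U N. r = norm (C U N \<sigma> \<omega>))"

definition M_max :: "(nat \<Rightarrow> int) \<Rightarrow> nat \<Rightarrow> real \<Rightarrow> real" where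
  "M_max U N \<sigma> = (GREATEST r. \<exists>\<omega>\<in>torus U N. r = norm (C U N \<sigma> \<omega>))"

definition R_tail :: "(nat \<Rightarrow> int) \<Rightarrow> nat \<Rightarrow> real \<Rightarrow> real" where
  "R_tail U N \<sigma> = (\<Sum>\<^sub>\<infinity>n\<in>{N<..}. of_int (U n) powr (-\<sigma>))"

definition A_tail :: "(nat \<Rightarrow> int) \<Rightarrow> nat \<Rightarrow> real \<Rightarrow> real" where
  "A_tail U N \<sigma> = (GREATEST a. \<exists>n>N. a = of_int (U n) powr (-\<sigma>))"

definition l_tail :: "(nat \<Rightarrow> int) \<Rightarrow> nat \<Rightarrow> real \<Rightarrow> real" where
  "l_tail U N \<sigma> = max (2 * A_tail U N \<sigma> - R_tail U N \<sigma>) 0"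

text \<open>The extrema over the torus are attained, and so is \<open>A_tail\<close> for a positive sequence, so
  \<open>LEAST\<close> and \<open>GREATEST\<close> denote actual minima and maxima.\<close>

lemma compact_torus: "compact (torus U N)"
proof -
  have "torus U N = (\<Pi>\<^sub>E p\<in>UNIV. if p \<in> prime_set U N then sphere 0 1 else {undefined})"
    by (fastforce simp: torus_def PiE_iff extensional_def split: if_splits)
  moreover have "compactin (product_topology (\<lambda>_. euclidean) UNIV)
     (\<Pi>\<^sub>E p\<in>UNIV. if p \<in> prime_set U N then sphere 0 1 else {undefined :: complex})"
    by (subst compactin_PiE) auto
  ultimately show ?thesis
    by (simp add: euclidean_product_topology)
qed

lemma torus_nonempty: "torus U N \<noteq> {}"
  by (auto simp: torus_def PiE_eq_empty_iff intro!: exI[of _ 1])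

lemma continuous_on_norm_C: "continuous_on (torus U N) (\<lambda>\<omega>. norm (C U N \<sigma> \<omega>))"
  unfolding C_def
  by (intro continuous_intros continuous_on_subset[OF continuous_on_product_coordinates]) auto

lemma m_min_attained:
  shows "\<exists>\<omega>\<in>torus U N. m_min U N \<sigma> = norm (C U N \<sigma> \<omega>)"
    and "\<omega> \<in> torus U N \<Longrightarrow> m_min U N \<sigma> \<le> norm (C U N \<sigma> \<omega>)"
proof -
  obtain w where w: "w \<in> torus U N"
      "\<And>v. v \<in> torus U N \<Longrightarrow> norm (C U N \<sigma> w) \<le> norm (C U N \<sigma> v)"
    using continuous_attains_inf[OF compact_torus torus_nonempty continuous_on_norm_C] by blast
  have "m_min U N \<sigma> = norm (C U N \<sigma> w)"
    unfolding m_min_def by (rule Least_equality) (use w in auto)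
  with w show "\<exists>\<omega>\<in>torus U N. m_min U N \<sigma> = norm (C U N \<sigma> \<omega>)"
    and "\<omega> \<in> torus U N \<Longrightarrow> m_min U N \<sigma> \<le> norm (C U N \<sigma> \<omega>)" by auto
qed

lemma M_max_attained:
  shows "\<exists>\<omega>\<in>torus U N. M_max U N \<sigma> = norm (C U N \<sigma> \<omega>)"
    and "\<omega> \<in> torus U N \<Longrightarrow> norm (C U N \<sigma> \<omega>) \<le> M_max U N \<sigma>"
proof -
  obtain w where w: "w \<in> torus U N"
      "\<And>v. v \<in> torus U N \<Longrightarrow> norm (C U N \<sigma> v) \<le> norm (C U N \<sigma> w)"
    using continuous_attains_sup[OF compact_torus torus_nonempty continuous_on_norm_C] by blast
  have "M_max U N \<sigma> = norm (C U N \<sigma> w)"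
    unfolding M_max_def by (rule Greatest_equality) (use w in auto)
  with w show "\<exists>\<omega>\<in>torus U N. M_max U N \<sigma> = norm (C U N \<sigma> \<omega>)"
    and "\<omega> \<in> torus U N \<Longrightarrow> norm (C U N \<sigma> \<omega>) \<le> M_max U N \<sigma>" by auto
qed

lemma A_tail_attained:
  assumes pos: "\<And>n. n \<ge> 1 \<Longrightarrow> U n > 0" and "\<sigma> > 0"
  shows "\<exists>n>N. A_tail U N \<sigma> = of_int (U n) powr (-\<sigma>)"
    and "n > N \<Longrightarrow> of_int (U n) powr (-\<sigma>) \<le> A_tail U N \<sigma>"
proof -
  define n0 where "n0 = (ARG_MIN (\<lambda>n. nat (U n)) n. n > N)"
  have n0: "n0 > N" "\<And>n. n > N \<Longrightarrow> nat (U n0) \<le> nat (U n)"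
    unfolding n0_def by (rule arg_min_natI[of _ "Suc N"], simp) (rule arg_min_nat_le)
  have le: "of_int (U n) powr (-\<sigma>) \<le> (of_int (U n0) :: real) powr (-\<sigma>)" if "n > N" for n
    using n0(1) n0(2)[OF that] pos[of n0] pos[of n] that assms(2)
    by (intro powr_mono2') auto
  have "A_tail U N \<sigma> = of_int (U n0) powr (-\<sigma>)"
    unfolding A_tail_def by (rule Greatest_equality) (use n0 le in auto)
  with n0 le show "\<exists>n>N. A_tail U N \<sigma> = of_int (U n) powr (-\<sigma>)"
    and "n > N \<Longrightarrow> of_int (U n) powr (-\<sigma>) \<le> A_tail U N \<sigma>" by auto
qed

end

theory Submission
  imports Defs "HOL-Complex_Analysis.Complex_Analysis" "HOL-Number_Theory.Totient"
begin

text \<open>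
  Since the logarithms of the primes are linearly independent over the rationals, Kronecker's theorem
  lets vertical translates of \<open>Z\<close> approximate every twist
  \<open>\<Sum>n. \<chi> (U n) * U n powr (- s)\<close> by a completely multiplicative unimodular \<open>\<chi>\<close>. By Hurwitz'
  theorem the closure of the real parts therefore contains each \<open>\<sigma> > 0\<close> at which some twist vanishes.
  Primitive primes make the phases of the terms with \<open>n > N\<close> independent of each other and of the head
  \<open>C U N \<sigma> \<omega>\<close>, so the tail of the twisted series takes every value of modulus between
  \<open>l_tail\<close> and \<open>R_tail\<close> (a polygon with infinitely many sides), while connectedness of the torus makes
  the modulus of the head take every value between \<open>m_min\<close> and \<open>M_max\<close>. Conversely, at a zero the head
  cancels the tail, and the resulting inequalities persist under limits.

  That \<open>N = 30\<close> is admissible is Carmichael's theorem, as the roots \<open>\<alpha>, \<beta>\<close> are real: without a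
  primitive prime, the value of the \<open>n\<close>-th homogeneous cyclotomic polynomial at \<open>(\<alpha>, \<beta>)\<close> is at most
  a prime factor of \<open>n\<close>; but it is at least its value for the Mersenne or for the Fibonacci numbers,
  which grows exponentially with \<open>totient n\<close>.
\<close>

section \<open>Divisibility in Lucas sequences\<close>

text \<open>Tail phases can be corrected only in increasing order of \<open>n\<close>: a primitive
  prime of \<open>U n\<close> may divide later terms, but no earlier one. So a completely
  multiplicative function with the prescribed phases is built only up to an index \<open>K\<close>.
  Kronecker's theorem turns it into a time \<open>t K\<close> with error below
  \<open>1 / (K + 1)\<close> on these terms, and the translates by the times \<open>t K\<close>
  converge to the wanted twist as \<open>K\<close> grows. Hurwitz' theorem would fail if this limit
  vanished identically. That is excluded far to the right, where only terms with
  \<open>U n = 1\<close> survive. There may be several of them, since \<open>U 2 = P\<close> can be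
  1, but all have phase 1: a term 1 has no prime divisor, so its index is at most \<open>N\<close>,
  and every character is 1 there. In Carmichael's theorem one Moebius sum of the numbers
  \<open>ln (U m)\<close> is evaluated twice: over the primes through valuations, which bounds it
  from above, and over roots of unity, which bounds it from below. The bound \<open>n > 30\<close>
  enters through the exceptional case \<open>n = r * p ^ k\<close> with
  \<open>r \<le> p + 1\<close>, where it forces \<open>totient n \<ge> 6\<close>.\<close>

locale lucas =
  fixes P Q :: int and U :: "nat \<Rightarrow> int"
  assumes coprime_PQ: "coprime P Q"
    and U_0: "U 0 = 0" and U_1: "U (Suc 0) = 1"
    and U_rec: "U (Suc (Suc n)) = P * U (Suc n) - Q * U n"
    and U_pos: "n \<ge> 1 \<Longrightarrow> U n > 0"
begin

text \<open>The \<open>n\<close>-th power of the companion matrix \<open>M\<close> of the recurrence is \<open>U n * M + T n * I\<close>.\<close>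

definition T :: "nat \<Rightarrow> int" where "T n = U (Suc n) - P * U n"

lemma U_Suc: "U (Suc n) = P * U n + T n"
  and T_0: "T 0 = 1"
  and T_Suc: "T (Suc n) = - Q * U n"
  by (simp_all add: T_def U_0 U_1 U_rec)

text \<open>Multiply \<open>U m * M + T m * I\<close> by \<open>U n * M + T n * I\<close> and reduce
  with \<open>M^2 = P * M - Q * I\<close>.\<close>

lemma U_T_add:
  "U (m + n) = P * U m * U n + U m * T n + U n * T m \<and> T (m + n) = T m * T n - Q * U m * U n"
  by (induction n) (simp_all add: U_0 T_0 U_Suc T_Suc algebra_simps)

lemmas U_add = conjunct1[OF U_T_add]
  and T_add = conjunct2[OF U_T_add]

text \<open>Both sides are the determinant of \<open>M ^ n\<close>. A prime dividing both
  \<open>U n\<close> and \<open>T n\<close> therefore divides \<open>Q\<close>, which coprimality of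
  \<open>P\<close> and \<open>Q\<close> forbids for \<open>n \<ge> 1\<close>.\<close>

lemma T_U_form: "(T n)^2 + P * T n * U n + Q * (U n)^2 = Q ^ n"
proof (induction n)
  case 0
  show ?case by (simp add: T_0 U_0)
next
  case (Suc n)
  have "(T (Suc n))^2 + P * T (Suc n) * U (Suc n) + Q * (U (Suc n))^2 =
      Q * ((T n)^2 + P * T n * U n + Q * (U n)^2)"
    unfolding T_Suc U_Suc by (simp add: power2_eq_square algebra_simps)
  then show ?case by (simp add: Suc)
qed

lemma Q_dvd_U_minus_power: "Q dvd U (Suc n) - P ^ n"
proof (induction n)
  case (Suc n)
  have "U (Suc (Suc n)) - P ^ Suc n = P * (U (Suc n) - P ^ n) - Q * U n"
    by (simp add: U_rec algebra_simps)
  then show ?case using Suc by (metis dvd_diff dvd_mult dvd_triv_left)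
qed (simp add: U_1)

lemma prime_dvd_U_not_dvd_Q:
  assumes "prime p" "p dvd U n" "n \<ge> 1"
  shows "\<not> p dvd Q"
proof
  assume "p dvd Q"
  obtain m where m: "n = Suc m" using assms(3) by (cases n) auto
  have "p dvd U (Suc m) - P ^ m" using \<open>p dvd Q\<close> Q_dvd_U_minus_power dvd_trans by blast
  with assms(2) m have "p dvd P ^ m" by (metis dvd_diff_right_iff)
  then have "p dvd P" using assms(1) prime_dvd_power by blast
  with \<open>p dvd Q\<close> coprime_PQ assms(1) show False
    by (meson coprime_common_divisor not_prime_unit)
qed

lemma prime_dvd_U_not_dvd_T:
  assumes "prime p" "p dvd U n" "n \<ge> 1"
  shows "\<not> p dvd T n"
proof
  assume "p dvd T n"
  with assms(2) have "p dvd (T n)^2 + P * T n * U n + Q * (U n)^2"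
    by (intro dvd_add) (auto simp: power2_eq_square)
  then have "p dvd Q ^ n" unfolding T_U_form .
  then show False using assms prime_dvd_U_not_dvd_Q prime_dvd_power by blast
qed

text \<open>The binomial expansion of \<open>(T m * I + U m * M) ^ k\<close> with powers of
  \<open>M\<close> reduced; \<open>x\<close> and \<open>y\<close> collect the higher order terms.
  The quadratic term is kept because lifting the exponent needs the cofactor of \<open>U m\<close>
  modulo \<open>p^2\<close>. Truncated exponents are harmless, as their coefficients vanish.\<close>

lemma U_T_mult:
  "\<exists>x y. U (m * k) = of_nat k * T m ^ (k - 1) * U m
            + of_nat (k choose 2) * P * T m ^ (k - 2) * (U m)^2 + x * (U m)^3
       \<and> T (m * k) = T m ^ k + y * (U m)^2"
proof (induction k)
  case 0
  show ?case by (auto simp: U_0 T_0 intro: exI[of _ 0])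
next
  case (Suc k)
  define u t where "u = U m" and "t = T m"
  from Suc obtain x y where xy:
    "U (m * k) = of_nat k * t ^ (k - 1) * u + of_nat (k choose 2) * P * t ^ (k - 2) * u^2 + x * u^3"
    "T (m * k) = t ^ k + y * u^2"
    unfolding u_def t_def by blast
  have eq: "m * Suc k = m + m * k" by simp
  have U: "U (m * Suc k) = P * u * U (m * k) + u * T (m * k) + U (m * k) * t"
    and T: "T (m * Suc k) = t * T (m * k) - Q * u * U (m * k)"
    unfolding eq U_add T_add u_def t_def by simp_all
  have k1: "of_nat k * t ^ (k - 1) * t = of_nat k * t ^ k"
    by (cases k) auto
  have k2: "of_nat (k choose 2) * t ^ (k - 2) * t = of_nat (k choose 2) * t ^ (k - 1)"
  proof (cases "k \<ge> 2")
    case True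
    then have "k - 1 = Suc (k - 2)" by simp
    then show ?thesis by simp
  qed (simp add: binomial_eq_0)
  have k3: "of_nat (Suc k choose 2) = (of_nat k + of_nat (k choose 2) :: int)"
    by (simp add: numeral_2_eq_2)
  define x' where "x' = P * (of_nat (k choose 2) * P * t ^ (k - 2) + x * u) + y + x * t"
  define y' where "y' = t * y - Q * (of_nat k * t ^ (k - 1) + of_nat (k choose 2) * P * t ^ (k - 2) * u + x * u^2)"
  have "U (m * Suc k) = P * u * (of_nat k * t ^ (k - 1) * u) + u * t ^ k
      + (of_nat k * t ^ (k - 1) * t) * u + (of_nat (k choose 2) * t ^ (k - 2) * t) * P * u^2 + x' * u^3"
    unfolding U xy x'_def by (simp add: algebra_simps power2_eq_square power3_eq_cube)
  also have "\<dots> = of_nat (Suc k) * t ^ k * u + of_nat (Suc k choose 2) * P * t ^ (k - 1) * u^2 + x' * u^3"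
    unfolding k1 k2 k3 by (simp add: algebra_simps power2_eq_square)
  finally have 1: "U (m * Suc k) = \<dots>" .
  have 2: "T (m * Suc k) = t ^ Suc k + y' * u^2"
    unfolding T xy y'_def by (simp add: algebra_simps power2_eq_square power3_eq_cube)
  show ?case
    using 1 2 unfolding u_def t_def by (intro exI[of _ x'] exI[of _ y']) simp
qed

lemma U_mult:
  obtains x where "U (m * k) = U m * (of_nat k * T m ^ (k - 1)
    + of_nat (k choose 2) * P * T m ^ (k - 2) * U m + x * (U m)^2)"
proof -
  from U_T_mult[of m k] obtain x where
    "U (m * k) = of_nat k * T m ^ (k - 1) * U m
       + of_nat (k choose 2) * P * T m ^ (k - 2) * (U m)^2 + x * (U m)^3" by blast
  then have "U (m * k) = U m * (of_nat k * T m ^ (k - 1)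
    + of_nat (k choose 2) * P * T m ^ (k - 2) * U m + x * (U m)^2)"
    by (simp add: algebra_simps power2_eq_square power3_eq_cube)
  with that show thesis .
qed

lemma U_dvd: "m dvd n \<Longrightarrow> U m dvd U n"
  by (metis U_mult dvdE dvd_triv_left)

text \<open>Modulo \<open>p\<close> the cofactor of \<open>U m\<close> in \<open>U_mult\<close> is
  \<open>k * T m ^ (k - 1)\<close>, a unit.\<close>

lemma multiplicity_U_mult_coprime:
  assumes p: "prime p" and dvd: "int p dvd U m" and m: "m \<ge> 1" and k: "\<not> p dvd k"
  shows "multiplicity (int p) (U (m * k)) = multiplicity (int p) (U m)"
proof -
  obtain x where x: "U (m * k) = U m * (of_nat k * T m ^ (k - 1)
    + of_nat (k choose 2) * P * T m ^ (k - 2) * U m + x * (U m)^2)" (is "_ = _ * ?w")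
    using U_mult .
  have pp: "prime (int p)" using p by simp
  have "\<not> int p dvd of_nat k * T m ^ (k - 1)"
    using prime_dvd_U_not_dvd_T[OF pp dvd m] k pp
    by (metis int_dvd_int_iff prime_dvd_mult_iff prime_dvd_power)
  moreover have "int p dvd of_nat (k choose 2) * P * T m ^ (k - 2) * U m + x * (U m)^2"
    using dvd by (auto simp: power2_eq_square intro!: dvd_add)
  ultimately have w: "\<not> int p dvd ?w"
    by (metis (no_types, lifting) add.assoc dvd_add_left_iff)
  then have "?w \<noteq> 0" by (metis dvd_0_right)
  moreover have "U m \<noteq> 0" using U_pos[OF m] by simp
  ultimately show ?thesis
    unfolding x using pp w by (simp add: prime_elem_multiplicity_mult_distrib not_dvd_imp_multiplicity_0)
qed

text \<open>Modulo \<open>p^2\<close> the cofactor of \<open>U m\<close> in \<open>U_mult\<close> is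
  \<open>p * T m ^ (p - 1)\<close>. For odd \<open>p\<close> the binomial coefficient supplies the
  second factor \<open>p\<close> of the quadratic term; for \<open>p = 2\<close> it is 1, so the
  factor 4 has to come from \<open>P * U m\<close>.\<close>

lemma multiplicity_U_mult_prime:
  assumes p: "prime p" and dvd: "int p dvd U m" and m: "m \<ge> 1"
    and two: "p = 2 \<Longrightarrow> 4 dvd P * U m"
  shows "multiplicity (int p) (U (m * p)) = Suc (multiplicity (int p) (U m))"
proof -
  obtain x where x: "U (m * p) = U m * (of_nat p * T m ^ (p - 1)
    + of_nat (p choose 2) * P * T m ^ (p - 2) * U m + x * (U m)^2)" (is "_ = _ * (?a + ?b + ?c)")
    using U_mult .
  have pp: "prime (int p)" using p by simp
  have c: "int p ^ 2 dvd ?c" using dvd by (simp add: dvd_power_same)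
  have b: "int p ^ 2 dvd ?b"
  proof (cases "p = 2")
    case True
    then show ?thesis using two by (auto simp: mult.assoc)
  next
    case False
    with p have "p > 2" by (metis nat_neq_iff not_less prime_ge_2_nat)
    then have "p dvd p choose 2" using p by (intro dvd_choose_prime) auto
    then have "int p * int p dvd int (p choose 2) * U m" using dvd by (intro mult_dvd_mono) auto
    then have "int p * int p dvd (int (p choose 2) * U m) * (P * T m ^ (p - 2))" by (rule dvd_mult2)
    then show ?thesis by (simp add: power2_eq_square ac_simps)
  qed
  from b c have "int p ^ 2 dvd ?b + ?c" by (rule dvd_add)
  then obtain z where z: "?b + ?c = int p ^ 2 * z" by (elim dvdE)
  have w: "?a + ?b + ?c = int p * (T m ^ (p - 1) + int p * z)" (is "_ = _ * ?v")
    using z by (simp add: algebra_simps power2_eq_square)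
  have "\<not> int p dvd T m ^ (p - 1)"
    using prime_dvd_U_not_dvd_T[OF pp dvd m] pp prime_dvd_power by blast
  then have v: "\<not> int p dvd ?v" by (simp add: dvd_add_left_iff)
  then have "?v \<noteq> 0" by (metis dvd_0_right)
  moreover have "U m \<noteq> 0" using U_pos[OF m] by simp
  moreover have "p \<noteq> 0" using p by auto
  ultimately show ?thesis
    unfolding x w using pp v
    by (simp add: prime_elem_multiplicity_mult_distrib not_dvd_imp_multiplicity_0)
qed

text \<open>The analogue of d'Ocagne's identity: one step of the recurrence multiplies this two by
  two determinant by \<open>Q\<close>. It is the numerator of the difference of the quotients
  \<open>U (i + 1) / U i\<close> at two indices.\<close>

lemma U_cross: "U (Suc (i + d)) * U i - U (Suc i) * U (i + d) = - (Q ^ i * U d)"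
proof (induction i)
  case 0
  show ?case by (simp add: U_0 U_1)
next
  case (Suc i)
  have "U (Suc (Suc i + d)) * U (Suc i) - U (Suc (Suc i)) * U (Suc i + d)
      = Q * (U (Suc (i + d)) * U i - U (Suc i) * U (i + d))"
    by (simp add: U_rec algebra_simps)
  then show ?case by (simp add: Suc)
qed

text \<open>The rank of apparition of \<open>p\<close>; meaningless if \<open>p\<close> divides no term.\<close>

definition apparition :: "nat \<Rightarrow> nat" where
  "apparition p = (LEAST j. j \<ge> 1 \<and> int p dvd U j)"

context
  fixes p n :: nat
  assumes p: "prime p" and n: "n \<ge> 1" and pn: "int p dvd U n"
begin

lemma apparition_ge_1: "apparition p \<ge> 1" and dvd_U_apparition: "int p dvd U (apparition p)"
  using LeastI[of "\<lambda>j. j \<ge> 1 \<and> int p dvd U j" n] n pn unfolding apparition_def by auto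

lemma apparition_le: "j \<ge> 1 \<Longrightarrow> int p dvd U j \<Longrightarrow> apparition p \<le> j"
  unfolding apparition_def by (rule Least_le) simp

text \<open>For a positive multiple \<open>m\<close> of the rank, \<open>U (j + m)\<close> is
  \<open>U j * T m\<close> modulo \<open>p\<close>, and \<open>T m\<close> is a unit.\<close>

lemma dvd_U_add_apparition_iff: "int p dvd U (j + apparition p * k) \<longleftrightarrow> int p dvd U j"
proof (cases "k = 0")
  case False
  let ?m = "apparition p * k"
  have m: "?m \<ge> 1" using False apparition_ge_1 by simp
  have d: "int p dvd U ?m" using dvd_U_apparition U_dvd[of "apparition p" ?m] dvd_trans by auto
  have nT: "\<not> int p dvd T ?m" using prime_dvd_U_not_dvd_T[OF _ d m] p by simp
  have "U (j + ?m) = U j * T ?m + U ?m * (P * U j + T j)"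
    by (simp add: U_add algebra_simps)
  then have "int p dvd U (j + ?m) \<longleftrightarrow> int p dvd U j * T ?m"
    using d by (simp add: dvd_add_left_iff)
  also have "\<dots> \<longleftrightarrow> int p dvd U j" using nT p by (simp add: prime_dvd_mult_iff)
  finally show ?thesis .
qed auto

lemma dvd_U_iff_apparition_dvd: "int p dvd U j \<longleftrightarrow> apparition p dvd j"
proof -
  have "int p dvd U j \<longleftrightarrow> int p dvd U (j mod apparition p)"
    using dvd_U_add_apparition_iff[of "j mod apparition p" "j div apparition p"] by simp
  also have "\<dots> \<longleftrightarrow> j mod apparition p = 0"
  proof
    assume "int p dvd U (j mod apparition p)"
    moreover have "j mod apparition p < apparition p" using apparition_ge_1 by simp
    ultimately show "j mod apparition p = 0" using apparition_le[of "j mod apparition p"] by linarith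
  qed (simp add: U_0)
  finally show ?thesis by auto
qed

text \<open>The quotients \<open>U (i + 1) / U i\<close> are pairwise distinct modulo \<open>p\<close> for \<open>0 < i < apparition p\<close>.\<close>

lemma apparition_le_Suc: "apparition p \<le> Suc p"
proof -
  define r where "r = apparition p"
  have pp: "prime (int p)" using p by simp
  have ninv: "\<exists>v. [U i * v = 1] (mod int p)" if "i \<in> {1..<r}" for i
  proof -
    have "\<not> int p dvd U i" using that apparition_le[of i] unfolding r_def by force
    then have "coprime (U i) (int p)" using pp by (simp add: coprime_commute prime_imp_coprime)
    then show ?thesis by (rule cong_solve_coprime_int)
  qed
  then obtain v where v: "\<And>i. i \<in> {1..<r} \<Longrightarrow> [U i * v i = 1] (mod int p)" by metis
  define f where "f i = (U (Suc i) * v i) mod int p" for i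
  have neq: "f i \<noteq> f j" if ij: "i \<in> {1..<r}" "j \<in> {1..<r}" "i < j" for i j
  proof
    assume "f i = f j"
    then have e: "[U (Suc i) * v i = U (Suc j) * v j] (mod int p)" by (simp add: f_def cong_def)
    have "[U (Suc i) * U j * (U i * v i) = U (Suc j) * U i * (U j * v j)] (mod int p)"
      using cong_scalar_left[OF e, of "U i * U j"] by (simp add: mult_ac)
    moreover have "[U (Suc i) * U j * (U i * v i) = U (Suc i) * U j * 1] (mod int p)"
      "[U (Suc j) * U i * (U j * v j) = U (Suc j) * U i * 1] (mod int p)"
      using v ij by (blast intro: cong_scalar_left)+
    ultimately have "[U (Suc j) * U i = U (Suc i) * U j] (mod int p)"
      by (metis cong_sym cong_trans mult.right_neutral)
    then have "int p dvd U (Suc j) * U i - U (Suc i) * U j" by (simp add: cong_iff_dvd_diff)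
    then have "int p dvd Q ^ i * U (j - i)" using U_cross[of i "j - i"] ij by simp
    moreover have "\<not> int p dvd Q ^ i"
      using prime_dvd_U_not_dvd_Q[OF pp pn n] pp prime_dvd_power by blast
    ultimately have "int p dvd U (j - i)" using pp prime_dvd_mult_iff by blast
    then have "apparition p \<le> j - i" using ij by (intro apparition_le) auto
    then show False using ij by (simp add: r_def)
  qed
  have "inj_on f {1..<r}"
    by (rule inj_onI) (metis neq linorder_neqE_nat)
  moreover have "f ` {1..<r} \<subseteq> {0..<int p}"
    using p prime_gt_0_nat by (auto simp: f_def)
  ultimately have "card {1..<r} \<le> card {0..<int p}"
    by (intro card_inj_on_le[of f]) auto
  then show ?thesis by (simp add: r_def)
qed

end

end

section \<open>Cyclotomic values\<close>

lemma prod_roots_unity: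
  fixes x :: complex
  assumes "n > 0"
  shows "(\<Prod>z | z ^ n = 1. x - z) = x ^ n - 1"
proof -
  define p :: "complex poly" where "p = monom 1 n - 1"
  have deg: "degree p = n"
    using degree_add_eq_left[of "- 1" "monom (1::complex) n"] assms
    by (simp add: p_def degree_monom_eq)
  have "coeff p n = 1" unfolding p_def using assms by (simp add: coeff_1)
  then have lead: "lead_coeff p = 1" by (simp add: deg)
  have roots: "poly p z = 0 \<longleftrightarrow> z ^ n = 1" for z by (simp add: p_def poly_monom)
  have "rsquarefree p"
    unfolding rsquarefree_roots
  proof (intro allI notI)
    fix z assume z: "poly p z = 0 \<and> poly (pderiv p) z = 0"
    then have "z \<noteq> 0" using roots[of z] assms by (auto simp: power_0_left)
    with z assms show False by (simp add: p_def pderiv_diff pderiv_monom poly_monom)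
  qed
  then have "smult (lead_coeff p) (\<Prod>z | poly p z = 0. [:-z, 1:]) = p"
    by (rule complex_poly_decompose_rsquarefree)
  then have "poly (\<Prod>z | z ^ n = 1. [:-z, 1:]) x = poly p x" by (simp add: lead roots)
  then show ?thesis by (simp add: p_def poly_monom poly_prod)
qed

lemma prod_cis_diff:
  fixes a b :: complex
  assumes "n > 0"
  shows "(\<Prod>j=1..n. a - cis (2 * pi * real j / real n) * b) = a ^ n - b ^ n"
proof -
  let ?f = "\<lambda>j. a - cis (2 * pi * real j / real n) * b"
  \<comment> \<open>The index \<open>n\<close> gives the same factor as 0. The range
    \<open>1..n\<close> is the one in which \<open>totatives\<close> and multiples of a divisor are
    counted.\<close>
  have "prod ?f {1..n} = prod ?f {..<n}"
  proof -
    obtain m where m: "n = Suc m" using assms by (cases n) auto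
    have "?f n = ?f 0" using assms by simp
    then have "prod ?f (insert n {1..m}) = prod ?f (insert 0 {1..m})" by (subst (1 2) prod.insert) (auto simp: m)
    moreover have "insert n {1..m} = {1..n}" "insert 0 {1..m} = {..<n}" by (auto simp: m)
    ultimately show ?thesis by (simp del: prod.insert)
  qed
  also have "\<dots> = (\<Prod>z | z ^ n = 1. a - z * b)"
    using Complex.bij_betw_roots_unity[OF assms]
    by (intro prod.reindex_bij_betw[of "\<lambda>k. cis (2 * pi * real k / real n)" "{..<n}" _ "\<lambda>z. a - z * b"])
  also have "\<dots> = a ^ n - b ^ n"
  proof (cases "b = 0")
    case True
    have "card {z::complex. z ^ n = 1} = n" using Complex.card_roots_unity_eq[OF assms] .
    with True assms show ?thesis by (simp add: power_0_left)
  next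
    case False
    have "(\<Prod>z | z ^ n = 1. a - z * b) = (\<Prod>z | z ^ n = 1. b * (a / b - z))"
      using False by (intro prod.cong) (auto simp: field_simps)
    also have "\<dots> = b ^ n * ((a / b) ^ n - 1)"
      using Complex.card_roots_unity_eq[OF assms] prod_roots_unity[OF assms, of "a / b"]
      by (simp add: prod.distrib)
    also have "\<dots> = a ^ n - b ^ n" using False by (simp add: right_diff_distrib power_divide)
    finally show ?thesis .
  qed
  finally show ?thesis .
qed

section \<open>Moebius sums over squarefree divisors\<close>

lemma dvd_iff_prod_primes_dvd:
  fixes S :: "nat set"
  assumes "finite S" "\<And>p. p \<in> S \<Longrightarrow> prime p"
  shows "\<Prod>S dvd k \<longleftrightarrow> (\<forall>p\<in>S. p dvd k)"
  using assms
proof (induction S rule: finite_induct)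
  case (insert p S)
  have "coprime p (\<Prod>S)"
    using insert by (intro prod_coprime_right) (metis insert_iff primes_coprime)
  then have "p * \<Prod>S dvd k \<longleftrightarrow> p dvd k \<and> \<Prod>S dvd k"
    by (meson divides_mult dvd_mult_left dvd_mult_right)
  with insert show ?case by simp
qed simp

lemma prod_primes_pos: "S \<subseteq> prime_factors n \<Longrightarrow> (0::nat) < \<Prod>S"
  by (intro prod_pos) (auto dest!: subsetD intro: prime_gt_0_nat)

lemma prod_prime_factors_subset_dvd:
  fixes n :: nat
  assumes "S \<subseteq> prime_factors n"
  shows "\<Prod>S dvd n"
  using assms finite_subset[OF assms] by (subst dvd_iff_prod_primes_dvd) auto

text \<open>This is \<open>\<Sum>d dvd n. \<mu> d * h (n / d)\<close>: the squarefree divisors of \<open>n\<close> are the products of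
  sets of prime factors.\<close>

definition moebius_sum :: "nat \<Rightarrow> (nat \<Rightarrow> real) \<Rightarrow> real" where
  "moebius_sum n h = (\<Sum>S\<in>Pow (prime_factors n). (- 1) ^ card S * h (n div \<Prod>S))"

text \<open>Inclusion-exclusion: the indicator of coprimality to \<open>n\<close> is the product of
  \<open>1 - of_bool (p dvd k)\<close> over the primes of \<open>n\<close>. Expanding it leaves, for
  each \<open>S\<close>, the multiples of \<open>\<Prod>S\<close> up to \<open>n\<close>.\<close>

lemma sum_totatives:
  fixes f :: "nat \<Rightarrow> real"
  assumes n: "n > 0"
  shows "sum f (totatives n) =
    (\<Sum>S\<in>Pow (prime_factors n). (- 1) ^ card S * (\<Sum>j=1..n div \<Prod>S. f (\<Prod>S * j)))"
proof -
  have ind: "(\<Prod>p\<in>prime_factors n. 1 - of_bool (p dvd k)) = (of_bool (coprime k n) :: real)" for k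
  proof (cases "coprime k n")
    case True
    then have "\<not> p dvd k" if "p \<in> prime_factors n" for p
      using that by (metis coprime_common_divisor in_prime_factors_imp_dvd in_prime_factors_imp_prime not_prime_unit)
    then show ?thesis using True by simp
  next
    case False
    then obtain p where "prime p" "p dvd k" "p dvd n" using n
      by (metis coprime_iff_gcd_eq_1 gcd_dvd1 gcd_dvd2 dvd_trans prime_factor_nat)
    then have "\<exists>p\<in>prime_factors n. 1 - of_bool (p dvd k) = (0::real)"
      using n by (intro bexI[of _ p]) (auto simp: in_prime_factors_iff)
    then show ?thesis using False by (simp add: prod_zero)
  qed
  have S: "finite S" "\<And>p. p \<in> S \<Longrightarrow> prime p" if "S \<in> Pow (prime_factors n)" for S
    using that finite_subset[of S "prime_factors n"] by auto
  have "sum f (totatives n) = (\<Sum>k=1..n. f k * of_bool (coprime k n))"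
    by (rule sum.mono_neutral_cong_left) (auto simp: totatives_def)
  also have "\<dots> = (\<Sum>k=1..n. \<Sum>S\<in>Pow (prime_factors n). (- 1) ^ card S * (of_bool (\<Prod>S dvd k) * f k))"
  proof (rule sum.cong[OF refl])
    fix k
    have "of_bool (coprime k n) = (\<Sum>S\<in>Pow (prime_factors n). (- 1) ^ card S * (\<Prod>p\<in>S. of_bool (p dvd k)) :: real)"
      unfolding ind[symmetric] by (subst prod_diff_conv_sum) simp_all
    also have "\<dots> = (\<Sum>S\<in>Pow (prime_factors n). (- 1) ^ card S * of_bool (\<Prod>S dvd k))"
    proof (rule sum.cong[OF refl])
      fix S assume "S \<in> Pow (prime_factors n)"
      with S[OF this] show "(- 1) ^ card S * (\<Prod>p\<in>S. of_bool (p dvd k)) = (- 1) ^ card S * (of_bool (\<Prod>S dvd k) :: real)"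
        by (auto simp: dvd_iff_prod_primes_dvd)
    qed
    finally show "f k * of_bool (coprime k n) = (\<Sum>S\<in>Pow (prime_factors n). (- 1) ^ card S * (of_bool (\<Prod>S dvd k) * f k))"
      by (simp only: sum_distrib_left mult_ac)
  qed
  also have "\<dots> = (\<Sum>S\<in>Pow (prime_factors n). (- 1) ^ card S * (\<Sum>k=1..n. of_bool (\<Prod>S dvd k) * f k))"
    by (subst sum.swap) (simp only: sum_distrib_left)
  also have "\<dots> = (\<Sum>S\<in>Pow (prime_factors n). (- 1) ^ card S * (\<Sum>j=1..n div \<Prod>S. f (\<Prod>S * j)))"
  proof (rule sum.cong[OF refl], rule arg_cong[where f = "\<lambda>x. _ * x"])
    fix S assume "S \<in> Pow (prime_factors n)"
    then have e: "\<Prod>S > 0" using prod_primes_pos[of S n] by simp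
    let ?e = "\<Prod>S"
    have "(\<Sum>k=1..n. of_bool (?e dvd k) * f k) = sum f {k\<in>{1..n}. ?e dvd k}"
      by (rule sum.mono_neutral_cong_right) auto
    also have "{k\<in>{1..n}. ?e dvd k} = (\<lambda>j. ?e * j) ` {1..n div ?e}"
      using e by (fastforce simp: less_eq_div_iff_mult_less_eq mult_ac Suc_le_eq elim!: dvdE)
    also have "sum f \<dots> = (\<Sum>j=1..n div ?e. f (?e * j))"
      using e by (subst sum.reindex) (auto simp: inj_on_def)
    finally show "(\<Sum>k=1..n. of_bool (?e dvd k) * f k) = (\<Sum>j=1..n div ?e. f (?e * j))" .
  qed
  finally show ?thesis .
qed

text \<open>Adding \<open>q\<close> to \<open>S\<close> flips the sign. The sum therefore vanishes
  whenever \<open>h\<close> takes the same value at both members of each pair.\<close>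

lemma moebius_sum_pair:
  assumes q: "q \<in> prime_factors n"
  shows "moebius_sum n h = (\<Sum>S\<in>Pow (prime_factors n - {q}). (- 1) ^ card S *
    (h (n div \<Prod>S) - h (n div (q * \<Prod>S))))"
proof -
  let ?F = "prime_factors n - {q}"
  let ?g = "\<lambda>S. (- 1) ^ card S * h (n div \<Prod>S)"
  have eq: "prime_factors n = insert q ?F" using q by auto
  have fin: "finite S" "q \<notin> S" if "S \<in> Pow ?F" for S
    using that finite_subset[of S ?F] by auto
  have "moebius_sum n h = sum ?g (Pow ?F) + sum ?g (insert q ` Pow ?F)"
    unfolding moebius_sum_def by (subst eq, subst Pow_insert, rule sum.union_disjoint) auto
  also have "sum ?g (insert q ` Pow ?F) = (\<Sum>S\<in>Pow ?F. ?g (insert q S))"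
    by (subst sum.reindex) (auto intro!: inj_onI)
  also have "\<dots> = (\<Sum>S\<in>Pow ?F. - ((- 1) ^ card S * h (n div (q * \<Prod>S))))"
    using fin by (intro sum.cong) auto
  finally show ?thesis by (simp add: sum.distrib[symmetric] right_diff_distrib)
qed

text \<open>It makes the denominator of Binet's formula drop out of the Moebius sum of
  \<open>ln (U m)\<close>.\<close>

lemma moebius_sum_const:
  assumes "n > 1"
  shows "moebius_sum n (\<lambda>_. c) = 0"
proof -
  obtain q where "prime q" "q dvd n" using assms by (metis less_irrefl prime_factor_nat)
  then have "q \<in> prime_factors n" using assms by (auto simp: in_prime_factors_iff)
  then show ?thesis by (subst moebius_sum_pair) auto
qed

lemma moebius_sum_add: "moebius_sum n (\<lambda>m. g m + h m) = moebius_sum n g + moebius_sum n h"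
  by (simp add: moebius_sum_def sum.distrib algebra_simps)

lemma moebius_sum_cong:
  assumes "n > 0" "\<And>m. m dvd n \<Longrightarrow> g m = h m"
  shows "moebius_sum n g = moebius_sum n h"
  unfolding moebius_sum_def
proof (intro sum.cong refl, goal_cases)
  case (1 S)
  then have "\<Prod>S dvd n" by (intro prod_prime_factors_subset_dvd) auto
  then have "n div \<Prod>S dvd n" by (metis dvd_div_mult_self dvd_triv_left)
  then show ?case using assms by simp
qed

text \<open>The logarithm of the modulus of the homogeneous cyclotomic polynomial at \<open>(a, b)\<close>.\<close>

definition ln_cyclotomic :: "nat \<Rightarrow> real \<Rightarrow> real \<Rightarrow> real" where
  "ln_cyclotomic n a b = (\<Sum>k\<in>totatives n. ln (norm (of_real a - cis (2 * pi * real k / real n) * of_real b)))"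

lemma norm_cis_diff_pos:
  assumes "\<bar>b\<bar> < a"
  shows "norm (complex_of_real a - cis t * of_real b) > 0"
proof -
  have "norm (complex_of_real a) - norm (cis t * complex_of_real b) \<le> norm (complex_of_real a - cis t * of_real b)"
    by (rule norm_triangle_ineq2)
  then show ?thesis using assms by (simp add: norm_mult del: zero_less_norm_iff)
qed

text \<open>In \<open>sum_totatives\<close> the fractions \<open>\<Prod>S * j / n\<close> reduce to
  \<open>j / m\<close> with \<open>m = n div \<Prod>S\<close>, so each inner sum is the logarithm of
  \<open>a ^ m - b ^ m\<close>. The assumption \<open>\<bar>b\<bar> < a\<close> keeps every factor
  nonzero.\<close>

lemma ln_cyclotomic_eq:
  assumes n: "n > 0" and ab: "\<bar>b\<bar> < a"
  shows "ln_cyclotomic n a b = moebius_sum n (\<lambda>m. ln (a ^ m - b ^ m))"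
  unfolding ln_cyclotomic_def sum_totatives[OF n] moebius_sum_def
proof (intro sum.cong refl arg_cong[where f = "\<lambda>x. _ * x"])
  fix S assume "S \<in> Pow (prime_factors n)"
  then have e: "\<Prod>S > 0" and "\<Prod>S dvd n"
    using prod_primes_pos[of S n] prod_prime_factors_subset_dvd[of S n] by auto
  then obtain m where m: "n = \<Prod>S * m" by (elim dvdE)
  then have m0: "m > 0" using n by auto
  let ?f = "\<lambda>j. complex_of_real a - cis (2 * pi * real j / real m) * of_real b"
  have "(\<Sum>j=1..m. ln (norm (?f j))) = ln (norm (\<Prod>j=1..m. ?f j))"
    using norm_cis_diff_pos[OF ab] by (simp add: ln_prod prod_norm[symmetric])
  also have "(\<Prod>j=1..m. ?f j) = of_real (a ^ m - b ^ m)"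
    by (subst prod_cis_diff[OF m0]) simp
  also have "norm (complex_of_real (a ^ m - b ^ m)) = a ^ m - b ^ m"
  proof -
    have "b ^ m \<le> \<bar>b\<bar> ^ m" by (metis abs_ge_self power_abs)
    also have "\<dots> \<le> a ^ m" using ab by (intro power_mono) auto
    finally show ?thesis by (simp flip: of_real_power of_real_diff)
  qed
  finally have "(\<Sum>j=1..m. ln (norm (?f j))) = ln (a ^ m - b ^ m)" .
  moreover have "real (\<Prod>S * j) / real n = real j / real m" for j
    using e unfolding m of_nat_mult by (intro mult_divide_mult_cancel_left) linarith
  moreover have "n div \<Prod>S = m" using e by (subst m) simp
  ultimately show "(\<Sum>j=1..n div \<Prod>S. ln (norm (complex_of_real a - cis (2 * pi * real (\<Prod>S * j) / real n) * of_real b)))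
      = ln (a ^ (n div \<Prod>S) - b ^ (n div \<Prod>S))"
    by (simp only: times_divide_eq_right[symmetric])
qed

text \<open>\<open>1 - y - y^2\<close> is the beginning of Euler's pentagonal number series. The
  term \<open>y ^ (n + 1)\<close> strengthens the induction so that it absorbs the next factor, and
  later makes the bound strict.\<close>

lemma prod_one_minus_power_ge:
  fixes y :: real
  assumes "0 \<le> y" "y \<le> 1" "n \<ge> 1"
  shows "(\<Prod>j=1..n. 1 - y ^ j) \<ge> 1 - y - y^2 + y ^ (n + 1)"
  using assms(3)
proof (induction n rule: dec_induct)
  case base
  show ?case by (simp add: power2_eq_square)
next
  case (step n)
  have le: "y ^ (n + 1) \<le> y ^ 2" using assms step by (intro power_decreasing) auto
  have "(1 - y - y^2 + y ^ (n + 1)) * (1 - y ^ (n + 1)) =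
    1 - y - y^2 + y ^ (n + 2) + y ^ (n + 1) * (y ^ 2 - y ^ (n + 1))"
    by (simp add: algebra_simps power2_eq_square)
  also have "\<dots> \<ge> 1 - y - y^2 + y ^ (n + 2)" using le assms by simp
  finally have "1 - y - y^2 + y ^ (n + 2) \<le> (1 - y - y^2 + y ^ (n + 1)) * (1 - y ^ (n + 1))" .
  also have "\<dots> \<le> (\<Prod>j=1..n. 1 - y ^ j) * (1 - y ^ (n + 1))"
    using step assms by (intro mult_right_mono) (auto intro!: power_le_one simp del: power_Suc)
  finally show ?case by simp
qed

text \<open>The set \<open>S\<close> is recovered from \<open>\<Prod>S\<close> as the set of its
  prime divisors.\<close>

lemma inj_on_div_prod_prime_factors:
  fixes n :: nat
  assumes n: "n > 0"
  shows "inj_on (\<lambda>S. n div \<Prod>S) (Pow (prime_factors n))"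
proof (rule inj_onI)
  fix S S' assume S: "S \<in> Pow (prime_factors n)" "S' \<in> Pow (prime_factors n)" "n div \<Prod>S = n div \<Prod>S'"
  have d: "\<Prod>S dvd n" "\<Prod>S' dvd n" using S prod_prime_factors_subset_dvd by auto
  then have "\<Prod>S = \<Prod>S'" using S(3) n by (metis dvd_div_eq_mult dvd_mult_div_cancel mult_cancel_left mult_is_0 neq0_conv nonzero_mult_div_cancel_left)
  moreover have "X = {p. prime p \<and> p dvd \<Prod>X}" if "X \<in> Pow (prime_factors n)" for X
  proof -
    have fin: "finite X" using that finite_subset by auto
    have pr: "prime p" if "p \<in> X" for p using that \<open>X \<in> _\<close> by auto
    have "p \<in> X" if p: "prime p" "p dvd \<Prod>X" for p
    proof -
      obtain x where "x \<in> X" "p dvd x" using p fin by (auto simp: prime_dvd_prod_iff)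
      with pr p(1) show ?thesis using primes_dvd_imp_eq by blast
    qed
    moreover have "p dvd \<Prod>X" if "p \<in> X" for p using that fin by (rule dvd_prodI[rotated])
    ultimately show ?thesis using pr by auto
  qed
  ultimately show "S = S'" using S by metis
qed

text \<open>Whatever its sign, each term is at least \<open>ln (1 - \<bar>x\<bar> ^ m)\<close>,
  because \<open>1 + t \<le> 1 / (1 - t)\<close> for \<open>0 \<le> t < 1\<close>. The exponents
  \<open>m\<close> are distinct elements of \<open>1..n\<close>, so the full product over
  \<open>1..n\<close> gives a lower bound.\<close>

lemma moebius_sum_ln_one_minus_power_gt:
  fixes x :: real
  assumes n: "n > 0" and x0: "x \<noteq> 0" and x: "1 - \<bar>x\<bar> - x^2 > 0"
  shows "moebius_sum n (\<lambda>m. ln (1 - x ^ m)) > ln (1 - \<bar>x\<bar> - x^2)"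
proof -
  define y where "y = \<bar>x\<bar>"
  have y: "0 < y" "y < 1" "1 - y - y^2 > 0"
    using x0 x zero_le_power2[of x] unfolding y_def power2_abs by (simp, linarith, linarith)
  have ym: "0 < y ^ m" "y ^ m < 1" if "m \<ge> 1" for m
    using y that power_strict_decreasing[of 0 m y] by auto
  have "ln (1 - y - y^2) < ln (\<Prod>j=1..n. 1 - y ^ j)"
  proof (subst ln_less_cancel_iff)
    have "1 - y - y^2 < 1 - y - y^2 + y ^ (n + 1)" using y by simp
    also have "\<dots> \<le> (\<Prod>j=1..n. 1 - y ^ j)" using y n by (intro prod_one_minus_power_ge) auto
    finally show "1 - y - y^2 < (\<Prod>j=1..n. 1 - y ^ j)" .
  qed (use y ym in \<open>auto intro!: prod_pos\<close>)
  also have "\<dots> = (\<Sum>j=1..n. ln (1 - y ^ j))"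
    using ym by (intro ln_prod) (auto dest!: less_imp_neq)
  also have "\<dots> \<le> (\<Sum>j\<in>(\<lambda>S. n div \<Prod>S) ` Pow (prime_factors n). ln (1 - y ^ j))"
  proof -
    have sub: "(\<lambda>S. n div \<Prod>S) ` Pow (prime_factors n) \<subseteq> {1..n}"
    proof clarify
      fix S assume "S \<subseteq> prime_factors n"
      then have "\<Prod>S dvd n" by (rule prod_prime_factors_subset_dvd)
      then have "n div \<Prod>S > 0" using n by (metis dvd_div_eq_0_iff neq0_conv)
      then show "n div \<Prod>S \<in> {1..n}" by simp
    qed
    have "(\<Sum>j\<in>{1..n}. - ln (1 - y ^ j)) \<ge> (\<Sum>j\<in>(\<lambda>S. n div \<Prod>S) ` Pow (prime_factors n). - ln (1 - y ^ j))"
      using sub ym y by (intro sum_mono2) auto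
    then show ?thesis by (simp add: sum_negf)
  qed
  also have "\<dots> = (\<Sum>S\<in>Pow (prime_factors n). ln (1 - y ^ (n div \<Prod>S)))"
    by (subst sum.reindex[OF inj_on_div_prod_prime_factors[OF n]]) simp
  also have "\<dots> \<le> moebius_sum n (\<lambda>m. ln (1 - x ^ m))"
    unfolding moebius_sum_def
  proof (rule sum_mono)
    fix S assume "S \<in> Pow (prime_factors n)"
    then have "\<Prod>S dvd n" by (intro prod_prime_factors_subset_dvd) auto
    then have m: "n div \<Prod>S \<ge> 1" using n by (metis dvd_div_eq_0_iff less_one linorder_not_less neq0_conv)
    let ?m = "n div \<Prod>S"
    have xy: "\<bar>x ^ ?m\<bar> = y ^ ?m" by (simp add: y_def power_abs)
    have a: "ln (1 - y ^ ?m) \<le> ln (1 - x ^ ?m)"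
      using xy ym[OF m] by (subst ln_le_cancel_iff) auto
    have "ln (1 - x ^ ?m) \<le> ln (1 + y ^ ?m)"
      using xy ym[OF m] by (subst ln_le_cancel_iff) auto
    also have "\<dots> \<le> ln (1 / (1 - y ^ ?m))"
      using ym[OF m] by (subst ln_le_cancel_iff) (auto simp: field_simps)
    also have "\<dots> = - ln (1 - y ^ ?m)" using ym[OF m] by (simp add: ln_div)
    finally have b: "ln (1 - y ^ ?m) \<le> - ln (1 - x ^ ?m)" by simp
    show "ln (1 - y ^ ?m) \<le> (- 1) ^ card S * ln (1 - x ^ ?m)"
      using a b by (cases "even (card S)") auto
  qed
  finally show ?thesis by (simp add: y_def)
qed

text \<open>Extracting \<open>a\<close> from each of the \<open>totient n\<close> factors leaves the
  value at \<open>(1, b / a)\<close>, whose logarithm is bounded below independently of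
  \<open>n\<close>.\<close>

lemma ln_cyclotomic_gt:
  assumes n: "n > 0" and a: "a > 0" and b: "b \<noteq> 0" and x: "1 - \<bar>b / a\<bar> - (b / a)^2 > 0"
  shows "ln_cyclotomic n a b > real (totient n) * ln a + ln (1 - \<bar>b / a\<bar> - (b / a)^2)"
proof -
  define x where "x = b / a"
  have x1: "\<bar>x\<bar> < 1" using x by (simp add: x_def[symmetric]) (smt (verit) zero_le_power2)
  have "ln_cyclotomic n a b = (\<Sum>k\<in>totatives n. ln a + ln (norm (1 - cis (2 * pi * real k / real n) * of_real x)))"
    unfolding ln_cyclotomic_def
  proof (intro sum.cong refl)
    fix k
    let ?z = "cis (2 * pi * real k / real n)"
    have "complex_of_real a - ?z * of_real b = of_real a * (1 - ?z * of_real x)"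
      using a by (simp add: x_def algebra_simps)
    then have "norm (complex_of_real a - ?z * of_real b) = a * norm (1 - ?z * of_real x)"
      using a by (simp add: norm_mult)
    then show "ln (norm (complex_of_real a - ?z * of_real b)) = ln a + ln (norm (1 - ?z * of_real x))"
      using norm_cis_diff_pos[of x 1] x1 a by (simp add: ln_mult)
  qed
  also have "\<dots> = real (totient n) * ln a + ln_cyclotomic n 1 x"
    by (simp add: ln_cyclotomic_def sum.distrib totient_def)
  also have "ln_cyclotomic n 1 x = moebius_sum n (\<lambda>m. ln (1 - x ^ m))"
    using ln_cyclotomic_eq[OF n, of x 1] x1 by simp
  finally have "ln_cyclotomic n a b = real (totient n) * ln a + moebius_sum n (\<lambda>m. ln (1 - x ^ m))" .
  moreover have "moebius_sum n (\<lambda>m. ln (1 - x ^ m)) > ln (1 - \<bar>x\<bar> - x^2)"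
    using n x b a by (intro moebius_sum_ln_one_minus_power_gt) (auto simp: x_def)
  ultimately show ?thesis unfolding x_def by linarith
qed

section \<open>Comparison of cyclotomic values at different parameters\<close>

lemma norm_cis_diff_sq:
  "(norm (complex_of_real a - cis t * of_real b))^2 = (a + b)^2 - 2 * (1 + cos t) * (a * b)"
proof -
  have "(norm (complex_of_real a - cis t * of_real b))^2 = (a - cos t * b)^2 + (sin t * b)^2"
    by (simp add: cmod_power2)
  also have "\<dots> = a^2 - 2 * cos t * (a * b) + ((sin t)^2 + (cos t)^2) * b^2"
    by algebra
  finally show ?thesis by (simp add: power2_eq_square algebra_simps)
qed

text \<open>The squared modulus of a factor is affine in \<open>u = 2 * (1 + cos t)\<close>, which
  ranges over \<open>0..4\<close>. Positivity of the smaller factors, from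
  \<open>\<bar>d\<bar> < c\<close>, permits taking logarithms.\<close>

lemma ln_cyclotomic_mono:
  assumes "\<bar>d\<bar> < c"
    and le: "\<And>u. 0 \<le> u \<Longrightarrow> u \<le> 4 \<Longrightarrow> (c + d)^2 - u * (c * d) \<le> (a + b)^2 - u * (a * b)"
  shows "ln_cyclotomic n c d \<le> ln_cyclotomic n a b"
  unfolding ln_cyclotomic_def
proof (rule sum_mono)
  fix k
  let ?t = "2 * pi * real k / real n"
  have "(norm (complex_of_real c - cis ?t * of_real d))^2 \<le> (norm (complex_of_real a - cis ?t * of_real b))^2"
    unfolding norm_cis_diff_sq using le[of "2 * (1 + cos ?t)"] cos_le_one[of ?t] cos_ge_minus_one[of ?t] by simp
  then have "norm (complex_of_real c - cis ?t * of_real d) \<le> norm (complex_of_real a - cis ?t * of_real b)"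
    by (rule power2_le_imp_le) simp
  then show "ln (norm (complex_of_real c - cis ?t * of_real d)) \<le> ln (norm (complex_of_real a - cis ?t * of_real b))"
    using norm_cis_diff_pos[OF assms(1), of ?t] by (subst ln_le_cancel_iff) linarith+
qed

section \<open>Primitive prime divisors\<close>

lemma multiplicity_int: "multiplicity (int p) (int x) = multiplicity p x"
  unfolding multiplicity_def by (simp flip: of_nat_power)

context lucas
begin

lemma multiplicity_U_eq_0: "\<not> int p dvd U m \<Longrightarrow> multiplicity (int p) (U m) = 0"
  by (rule not_dvd_imp_multiplicity_0)

text \<open>Pair \<open>S\<close> with \<open>S \<union> {q}\<close> for a prime \<open>q\<close> dividing \<open>n / apparition p\<close>. If \<open>q \<noteq> p\<close>, the
  \<open>p\<close>-adic valuations in each pair agree; if only \<open>q = p\<close> is available, the pair of \<open>S = {}\<close> alone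
  contributes, namely \<open>1\<close>.\<close>

lemma moebius_sum_multiplicity_U_le:
  assumes n: "n > 30" and prim: "\<not> has_primitive_prime_divisor U n" and p: "prime p"
  defines "h \<equiv> \<lambda>m. real (multiplicity (int p) (U m))"
  shows "moebius_sum n h \<le> of_bool (int p dvd U n \<and> (\<exists>k\<ge>1. n = apparition p * p ^ k))"
proof (cases "int p dvd U n")
  case False
  have "h m = 0" if "m dvd n" for m
    using False U_dvd[OF that] multiplicity_U_eq_0[of p m] dvd_trans unfolding h_def by auto
  then have "moebius_sum n h = moebius_sum n (\<lambda>_. 0)" using n by (intro moebius_sum_cong) auto
  then show ?thesis by (simp add: moebius_sum_def)
next
  case pU: True
  define r where "r = apparition p"
  have n1: "n \<ge> 1" using n by simp
  note app = dvd_U_iff_apparition_dvd[OF p n1 pU, folded r_def]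
  have r1: "r \<ge> 1" using apparition_ge_1[OF p n1 pU] by (simp add: r_def)
  obtain m where m: "n = r * m" using app[of n] pU by (elim dvdE iffD1[elim_format]) auto
  obtain j where j: "1 \<le> j" "j < n" "int p dvd U j"
    using prim pU p unfolding has_primitive_prime_divisor_def by auto
  have "r \<le> j" using apparition_le[OF p n1 pU] j by (simp add: r_def)
  with j m have m1: "m > 1" by (cases "m \<le> 1") (auto simp: le_Suc_eq)
  have subF: "\<Prod>S dvd n div q" "\<Prod>S > 0" "coprime (\<Prod>S) q" if "S \<in> Pow (prime_factors n - {q})" "q \<in> prime_factors n" for S q
  proof -
    have S: "S \<subseteq> prime_factors n" and fin: "finite S" using that finite_subset[of S "prime_factors n"] by auto
    show "\<Prod>S > 0" using prod_primes_pos[OF S] .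
    have q: "prime q" "q dvd n" using that by auto
    show co: "coprime (\<Prod>S) q"
      using that S q by (intro prod_coprime_left) (metis DiffD2 PowD in_prime_factors_imp_prime primes_coprime singletonI subsetD)
    have "q * \<Prod>S dvd n"
      using co q prod_prime_factors_subset_dvd[OF S] by (intro divides_mult) (auto simp: coprime_commute)
    then show "\<Prod>S dvd n div q" using q by (metis dvd_div_iff_mult mult.commute not_prime_0)
  qed
  show ?thesis
  proof (cases "\<exists>q. prime q \<and> q dvd m \<and> q \<noteq> p")
    case True
    then obtain q where q: "prime q" "q dvd m" "q \<noteq> p" by blast
    have qn: "q \<in> prime_factors n" using q m n by (auto simp: in_prime_factors_iff intro!: Nat.gr0I)
    have "h (n div \<Prod>S) = h (n div (q * \<Prod>S))" if S: "S \<in> Pow (prime_factors n - {q})" for S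
    proof -
      define e where "e = \<Prod>S"
      note e = subF[OF S qn, folded e_def]
      have "q dvd n" using qn by auto
      then obtain d where d: "n = q * (e * d)"
        using e(1) by (metis dvdE dvd_mult_div_cancel)
      have q0: "q > 0" using q prime_gt_0_nat by blast
      have div: "n div e = d * q" "n div (q * e) = d" using d e(2) q0 by simp_all
      have d1: "d \<ge> 1" using d n by (cases d) auto
      show ?thesis
      proof (cases "r dvd d")
        case True
        then have "int p dvd U d" by (simp add: app)
        moreover have "\<not> p dvd q" using p q primes_dvd_imp_eq by blast
        ultimately show ?thesis unfolding e_def[symmetric] div h_def
          using p d1 by (simp add: multiplicity_U_mult_coprime)
      next
        case False
        \<comment> \<open>Here \<open>n div e = d * q\<close>. If \<open>r\<close> divides it with
          quotient \<open>c\<close>, then \<open>e * c = m\<close>; as \<open>q\<close> divides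
          \<open>m\<close> and is coprime to \<open>e\<close>, it divides \<open>c\<close> and can
          be cancelled, so \<open>r\<close> divides \<open>d\<close>.\<close>
        have "\<not> r dvd d * q"
        proof
          assume "r dvd d * q"
          then obtain c where c: "d * q = r * c" by (elim dvdE)
          then have "r * (e * c) = r * m" using d m by (simp add: mult_ac)
          then have "e * c = m" using r1 by simp
          then have "q dvd e * c" using q by simp
          then have "q dvd c" using e(3) by (simp add: coprime_commute coprime_dvd_mult_right_iff)
          then obtain c' where "c = q * c'" by (elim dvdE)
          then have "d = r * c'" using c q0 by simp
          with False show False by simp
        qed
        then show ?thesis unfolding e_def[symmetric] div h_def
          using False by (simp add: multiplicity_U_eq_0 app)
      qed
    qed
    then have "moebius_sum n h = 0" by (subst moebius_sum_pair[OF qn]) simp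
    then show ?thesis by simp
  next
    case False
    then have "\<And>q. prime q \<Longrightarrow> q dvd m \<Longrightarrow> q = p" by blast
    then have "prime_factors m \<subseteq> {p}" by (auto simp: in_prime_factors_iff)
    then have "m = p ^ multiplicity p m"
      using m1 prod_prime_factors[of m] by (auto simp: subset_singleton_iff)
    then obtain k where mk: "m = p ^ k" by blast
    with m1 have k1: "k \<ge> 1" by (cases k) auto
    have pn: "p \<in> prime_factors n" using k1 mk m n p by (auto simp: in_prime_factors_iff intro!: Nat.gr0I)
    have p0: "p > 0" using p prime_gt_0_nat by blast
    define d where "d = r * p ^ (k - 1)"
    have nd: "n = d * p" using mk m k1 by (cases k) (auto simp: d_def)
    have d1: "d \<ge> 1" using nd n by (cases d) auto
    have rd: "int p dvd U d" by (simp add: app d_def)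
    \<comment> \<open>As \<open>r \<le> 3\<close> and \<open>n > 30\<close>, the exponent
      \<open>k\<close> is at least 2. Hence \<open>U (r + r)\<close>, a product of two even numbers,
      divides \<open>U d\<close>.\<close>
    have two: "4 dvd P * U d" if "p = 2"
    proof -
      have r3: "r \<le> 3" using apparition_le_Suc[OF p n1 pU] that by (simp add: r_def)
      have "k \<ge> 2"
      proof (rule ccontr)
        assume "\<not> k \<ge> 2"
        with k1 have "k = 1" by simp
        then show False using n r3 by (simp add: m mk that)
      qed
      then have "r + r dvd d" by (cases k; cases "k - 1") (auto simp: d_def that mult_2[symmetric])
      then have "U (r + r) dvd U d" by (rule U_dvd)
      moreover have "even (U r)" using app[of r] that by simp
      then have "4 dvd U (r + r)"
      proof -
        have "U (r + r) = U r * (P * U r + 2 * T r)" by (simp add: U_add algebra_simps)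
        moreover have "2 dvd P * U r + 2 * T r" using \<open>even (U r)\<close> by simp
        ultimately show ?thesis using mult_dvd_mono[OF \<open>even (U r)\<close>, of 2] by simp
      qed
      ultimately show ?thesis by (metis dvd_mult dvd_trans)
    qed
    have "(- 1) ^ card S * (h (n div \<Prod>S) - h (n div (p * \<Prod>S))) = (if S = {} then 1 else 0)"
      if S: "S \<in> Pow (prime_factors n - {p})" for S
    proof (cases "S = {}")
      case True
      have "n div p = d" using nd p0 by simp
      then show ?thesis using True multiplicity_U_mult_prime[OF p rd d1 two] by (simp add: h_def nd[symmetric])
    next
      case S0: False
      define e where "e = \<Prod>S"
      note e = subF[OF S pn, folded e_def]
      obtain d' where d': "d = e * d'" using e(1) nd p0 by auto
      have div: "n div e = d' * p" "n div (p * e) = d'" using d' nd e(2) p0 by (simp_all add: mult_ac)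
      have "e \<noteq> 1"
      proof -
        obtain q where q: "q \<in> S" using S0 by blast
        then have "q dvd e" using S finite_subset[of S "prime_factors n - {p}"] unfolding e_def by (intro dvd_prodI) auto
        moreover have "prime q" using q S by auto
        ultimately show ?thesis by auto
      qed
      \<comment> \<open>Since \<open>n = r * p ^ k\<close>, dividing \<open>n\<close> by
        \<open>e > 1\<close> coprime to \<open>p\<close> destroys divisibility by \<open>r\<close>;
        both valuations in the pair are 0.\<close>
      have "\<not> r dvd d' * p"
      proof
        assume "r dvd d' * p"
        then obtain c where "d' * p = r * c" by (elim dvdE)
        then have "r * (e * c) = r * p ^ k" using d' nd m mk by (simp add: mult_ac)
        then have "e * c = p ^ k" using r1 by simp
        then have "e dvd p ^ k" by (metis dvd_triv_left)
        moreover have "coprime e (p ^ k)" using e(3) by simp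
        ultimately show False using \<open>e \<noteq> 1\<close> by (metis coprime_absorb_left nat_dvd_1_iff_1)
      qed
      moreover from this have "\<not> r dvd d'" by auto
      ultimately show ?thesis using S0 unfolding e_def[symmetric] div h_def
        by (simp add: multiplicity_U_eq_0 app)
    qed
    then have "moebius_sum n h = (\<Sum>S\<in>Pow (prime_factors n - {p}). if S = {} then 1 else 0)"
      by (subst moebius_sum_pair[OF pn]) (rule sum.cong[OF refl])
    also have "\<dots> = 1" by (subst sum.delta) auto
    finally show ?thesis using pU m mk k1 by (auto simp: r_def)
  qed
qed

text \<open>If \<open>p < q\<close> are both exceptional, then \<open>q\<close> divides
  \<open>apparition p \<le> p + 1\<close>, so \<open>p = 2\<close>, \<open>q = 3\<close> and
  \<open>n = 3 * 2 ^ k\<close>. Comparing with \<open>n = apparition 3 * 3 ^ l\<close>, where the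
  rank is at most 4, gives \<open>n \<le> 12\<close>.\<close>

lemma exceptional_prime_unique:
  assumes n: "n > 30" and p: "prime p" "int p dvd U n" "k \<ge> 1" "n = apparition p * p ^ k"
    and q: "prime q" "int q dvd U n" "l \<ge> 1" "n = apparition q * q ^ l"
  shows "p = q"
proof -
  have False if "prime p" "int p dvd U n" "k \<ge> 1" "n = apparition p * p ^ k"
    and "prime q" "int q dvd U n" "l \<ge> 1" "n = apparition q * q ^ l" and lt: "p < q" for p q k l
  proof -
    have n1: "n \<ge> 1" using n by simp
    have "q dvd apparition p * p ^ k"
      using that(4,8,7) by (metis dvd_mult dvd_power le_eq_less_or_eq less_le_trans zero_less_one)
    moreover have "\<not> q dvd p ^ k" using that primes_dvd_imp_eq prime_dvd_power by (metis less_irrefl)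
    ultimately have qr: "q dvd apparition p" using \<open>prime q\<close> by (meson prime_dvd_mult_iff)
    then have "q \<le> Suc p"
      using apparition_le_Suc[OF that(1) n1 that(2)] apparition_ge_1[OF that(1) n1 that(2)]
        dvd_imp_le[OF qr] by linarith
    with lt have qp: "q = Suc p" by simp
    then have "p = 2 \<or> odd p" "even p \<or> odd p" using prime_odd_nat prime_ge_2_nat[OF \<open>prime p\<close>] that(1) by (metis le_neq_implies_less)+
    moreover have "odd q" using \<open>prime q\<close> lt prime_ge_2_nat[OF \<open>prime p\<close>] by (intro prime_odd_nat) auto
    ultimately have p2: "p = 2" and q3: "q = 3" using qp by auto
    have "apparition p \<le> 3" using apparition_le_Suc[OF that(1) n1 that(2)] p2 by simp
    with qr q3 apparition_ge_1[OF that(1) n1 that(2)] have r2: "apparition p = 3"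
      by (auto dest!: dvd_imp_le)
    have "n = 3 * 2 ^ k" using that(4) r2 p2 by simp
    moreover have r3: "apparition q \<le> 4" using apparition_le_Suc[OF that(5) n1 that(6)] q3 by simp
    ultimately have e: "3 * 2 ^ k = apparition q * 3 * 3 ^ (l - 1)"
      using that(7,8) q3 by (cases l) auto
    then have "2 ^ k = apparition q * 3 ^ (l - 1)" by simp
    then have "(3::nat) ^ (l - 1) dvd 2 ^ k" by (metis dvd_triv_right)
    moreover have "coprime ((3::nat) ^ (l - 1)) (2 ^ k)" by simp
    ultimately have "(3::nat) ^ (l - 1) = 1" by (metis coprime_absorb_left nat_dvd_1_iff_1)
    then have "n \<le> 12" using e r3 \<open>n = 3 * 2 ^ k\<close> by simp
    with n show False by simp
  qed
  from this[OF p q] this[OF q p] show ?thesis by (metis linorder_neqE_nat)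
qed

text \<open>The primes are indexed by the divisors of \<open>U n\<close> rather than of
  \<open>U m\<close>, so that the sum over primes can be exchanged with the Moebius sum over
  divisors of \<open>n\<close>.\<close>

lemma ln_U_eq:
  assumes "m dvd n" "n > 0"
  shows "ln (real_of_int (U m)) = (\<Sum>p | prime p \<and> int p dvd U n. real (multiplicity (int p) (U m)) * ln (real p))"
proof -
  let ?A = "{p. prime p \<and> int p dvd U n}"
  have m: "m \<ge> 1" using assms by (auto intro: Nat.gr0I)
  have Upos: "U n > 0" "U m > 0" using assms m U_pos by auto
  have A: "?A = prime_factors (nat (U n))"
    using Upos by (auto simp: in_prime_factors_iff nat_dvd_iff int_dvd_int_iff[symmetric])
  have fin: "finite ?A" unfolding A by simp
  have sub: "prime_factors (nat (U m)) \<subseteq> ?A"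
    using Upos U_dvd[OF assms(1)] by (auto simp: in_prime_factors_iff int_dvd_int_iff[symmetric] intro: dvd_trans)
  have mult: "multiplicity (int p) (U m) = multiplicity p (nat (U m))" for p
    using multiplicity_int[of p "nat (U m)"] Upos by simp
  have "real_of_int (U m) = real (nat (U m))" using Upos by simp
  also have "nat (U m) = (\<Prod>p\<in>prime_factors (nat (U m)). p ^ multiplicity p (nat (U m)))"
    using Upos by (simp add: prod_prime_factors)
  also have "\<dots> = (\<Prod>p\<in>?A. p ^ multiplicity p (nat (U m)))"
    using sub fin by (intro prod.mono_neutral_left) (auto simp: prime_factors_multiplicity)
  finally have "ln (real_of_int (U m)) = ln (\<Prod>p\<in>?A. real p ^ multiplicity (int p) (U m))"
    by (simp add: mult)
  also have "\<dots> = (\<Sum>p\<in>?A. ln (real p ^ multiplicity (int p) (U m)))"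
    using fin by (intro ln_prod) (auto simp: prime_gt_0_nat)
  also have "\<dots> = (\<Sum>p\<in>?A. real (multiplicity (int p) (U m)) * ln (real p))"
    by (intro sum.cong refl ln_realpow)
  finally show ?thesis .
qed

lemma moebius_sum_ln_U_le:
  assumes n: "n > 30" and prim: "\<not> has_primitive_prime_divisor U n"
  shows "moebius_sum n (\<lambda>m. ln (real_of_int (U m))) \<le> 0 \<or>
    (\<exists>p k. prime p \<and> int p dvd U n \<and> k \<ge> 1 \<and> n = apparition p * p ^ k \<and>
       moebius_sum n (\<lambda>m. ln (real_of_int (U m))) \<le> ln (real p))"
proof -
  let ?A = "{p. prime p \<and> int p dvd U n}"
  let ?E = "\<lambda>p. int p dvd U n \<and> (\<exists>k\<ge>1. n = apparition p * p ^ k)"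
  have "U n > 0" using n U_pos[of n] by simp
  then have "?A = prime_factors (nat (U n))"
    by (auto simp: in_prime_factors_iff nat_dvd_iff int_dvd_int_iff[symmetric])
  then have fin: "finite ?A" by simp
  have "moebius_sum n (\<lambda>m. ln (real_of_int (U m))) =
    moebius_sum n (\<lambda>m. \<Sum>p\<in>?A. real (multiplicity (int p) (U m)) * ln (real p))"
    using n by (intro moebius_sum_cong ln_U_eq) auto
  also have "\<dots> = (\<Sum>p\<in>?A. moebius_sum n (\<lambda>m. real (multiplicity (int p) (U m))) * ln (real p))"
    unfolding moebius_sum_def sum_distrib_left sum_distrib_right
    by (subst sum.swap) (simp add: mult_ac)
  also have "\<dots> \<le> (\<Sum>p\<in>?A. of_bool (?E p) * ln (real p))"
    using prime_ge_1_nat by (intro sum_mono mult_right_mono moebius_sum_multiplicity_U_le n prim) auto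
  finally have le: "moebius_sum n (\<lambda>m. ln (real_of_int (U m))) \<le> (\<Sum>p\<in>?A. of_bool (?E p) * ln (real p))" .
  show ?thesis
  proof (cases "\<exists>p\<in>?A. ?E p")
    case False
    then have "(\<Sum>p\<in>?A. of_bool (?E p) * ln (real p)) = 0" by (intro sum.neutral) auto
    with le show ?thesis by simp
  next
    case True
    then obtain p k where p: "prime p" "int p dvd U n" "k \<ge> 1" "n = apparition p * p ^ k" by blast
    have "?E q \<longleftrightarrow> q = p" if "q \<in> ?A" for q
      using that p exceptional_prime_unique[OF n p] by blast
    then have "(\<Sum>q\<in>?A. of_bool (?E q) * ln (real q)) = (\<Sum>q\<in>?A. if q = p then ln (real p) else 0)"
      by (intro sum.cong) auto
    also have "\<dots> = ln (real p)" using fin p by (subst sum.delta) auto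
    finally show ?thesis using le p by auto
  qed
qed

end

text \<open>Six is the least \<open>N\<close> with \<open>N + 1 \<le> 1.617 ^ N * 0.47\<close>, an
  inequality needed for Carmichael's theorem. For \<open>p \<ge> 7\<close> the factor
  \<open>p - 1\<close> suffices; smaller primes must divide \<open>n\<close> to a higher
  power.\<close>

lemma totient_ge_6:
  assumes n: "n > 30" and r: "r \<le> Suc p" and p: "prime p" and eq: "n = r * p ^ k" "k \<ge> 1"
  shows "totient n \<ge> 6" "p \<le> Suc (totient n)"
proof -
  have n0: "totient n > 0" using n by simp
  have mono: "totient d \<le> totient n" if "d dvd n" for d
    using totient_dvd[OF that] n0 by (rule dvd_imp_le)
  have pn: "p dvd n" using eq by auto
  then show p': "p \<le> Suc (totient n)" using mono[OF pn] totient_prime[OF p] by simp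
  have p2: "p \<ge> 2" using p prime_ge_2_nat by blast
  have pow: "totient (p ^ j) = p ^ (j - 1) * (p - 1)" if "j \<ge> 1" for j
    using totient_power[of j p] that totient_prime[OF p] by simp
  \<comment> \<open>If \<open>k < j\<close>, then
    \<open>n \<le> (p + 1) * p ^ (j - 1) \<le> 30\<close>. The choices are \<open>j = 4\<close> for
    \<open>p = 2\<close> and \<open>j = 2\<close> for 3 and 5; the bound 30 is attained at
    \<open>p = 5\<close>.\<close>
  have key: "totient n \<ge> 6" if "j \<ge> 1" "p ^ (j - 1) * (p - 1) \<ge> 6" "(p + 1) * p ^ (j - 1) \<le> 30" for j
  proof -
    have "j \<le> k"
    proof (rule ccontr)
      assume "\<not> j \<le> k"
      then have "p ^ k \<le> p ^ (j - 1)" using p2 by (intro power_increasing) auto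
      then have "r * p ^ k \<le> (p + 1) * p ^ (j - 1)" using r by (intro mult_mono) auto
      with that n eq show False by simp
    qed
    then have "p ^ j dvd n" using eq by (simp add: le_imp_power_dvd)
    from mono[OF this] show ?thesis using pow[of j] that by simp
  qed
  show "totient n \<ge> 6"
  proof (cases "p \<ge> 7")
    case True
    then show ?thesis using p' by simp
  next
    case False
    have "p = 2 \<or> odd p" using p p2 prime_odd_nat[OF p] by linarith
    then have "p = 2 \<or> p = 3 \<or> p = 5" using False p2 by presburger
    then show ?thesis using key[of 4] key[of 2] by auto
  qed
qed

context lucas
begin

lemma P_pos: "P > 0"
  using U_pos[of 2] U_rec[of 0] by (simp add: U_0 U_1 numeral_2_eq_2)

context
  fixes \<alpha> \<beta> :: real
  assumes PQ: "\<alpha> + \<beta> = of_int P" "\<alpha> * \<beta> = of_int Q" and lt: "\<beta> < \<alpha>"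
begin

lemma binet: "(\<alpha> - \<beta>) * of_int (U n) = \<alpha> ^ n - \<beta> ^ n \<and> (\<alpha> - \<beta>) * of_int (U (Suc n)) = \<alpha> ^ Suc n - \<beta> ^ Suc n"
proof (induction n)
  case (Suc n)
  have "(\<alpha> - \<beta>) * of_int (U (Suc (Suc n))) =
    (\<alpha> + \<beta>) * ((\<alpha> - \<beta>) * of_int (U (Suc n))) - \<alpha> * \<beta> * ((\<alpha> - \<beta>) * of_int (U n))"
    unfolding PQ U_rec by (simp add: algebra_simps)
  also have "\<dots> = (\<alpha> + \<beta>) * (\<alpha> ^ Suc n - \<beta> ^ Suc n) - \<alpha> * \<beta> * (\<alpha> ^ n - \<beta> ^ n)"
    using Suc by simp
  also have "\<dots> = \<alpha> ^ Suc (Suc n) - \<beta> ^ Suc (Suc n)" by (simp add: algebra_simps)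
  finally show ?case using Suc by simp
qed (simp_all add: U_0 U_1)

lemma ln_cyclotomic_eq_moebius_sum_U:
  assumes n: "n > 1"
  shows "ln_cyclotomic n \<alpha> \<beta> = moebius_sum n (\<lambda>m. ln (real_of_int (U m)))"
proof -
  have "\<bar>\<beta>\<bar> < \<alpha>" using PQ(1) P_pos lt by linarith
  then have "ln_cyclotomic n \<alpha> \<beta> = moebius_sum n (\<lambda>m. ln (\<alpha> ^ m - \<beta> ^ m))"
    using n by (intro ln_cyclotomic_eq) auto
  also have "\<dots> = moebius_sum n (\<lambda>m. ln (\<alpha> - \<beta>) + ln (real_of_int (U m)))"
  proof (rule moebius_sum_cong)
    fix m assume "m dvd n"
    then have "U m > 0" using n by (intro U_pos) (auto intro!: Nat.gr0I simp: Suc_le_eq)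
    then show "ln (\<alpha> ^ m - \<beta> ^ m) = ln (\<alpha> - \<beta>) + ln (real_of_int (U m))"
      using lt ln_mult[of "\<alpha> - \<beta>" "of_int (U m)"] binet[of m] by simp
  qed (use n in simp)
  also have "\<dots> = moebius_sum n (\<lambda>m. ln (real_of_int (U m)))"
    using n by (simp add: moebius_sum_add moebius_sum_const)
  finally show ?thesis .
qed

text \<open>The modulus of the cyclotomic value is smallest for the Mersenne numbers (\<open>Q > 0\<close>) and for
  the Fibonacci numbers (\<open>Q < 0\<close>): compare \<open>|\<alpha> - \<zeta> \<beta>|\<^sup>2 = P\<^sup>2 - u Q\<close> with \<open>0 \<le> u \<le> 4\<close> factor by factor.\<close>

lemma ln_cyclotomic_ge:
  assumes D: "P^2 - 4 * Q > 0" and "Q \<noteq> 0"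
  shows "ln_cyclotomic n 2 1 \<le> ln_cyclotomic n \<alpha> \<beta> \<or>
    ln_cyclotomic n ((1 + sqrt 5) / 2) ((1 - sqrt 5) / 2) \<le> ln_cyclotomic n \<alpha> \<beta>"
proof (cases "Q > 0")
  case True
  have "(2 + 1)^2 - u * (2 * 1) \<le> (of_int P)^2 - u * real_of_int Q" if u: "0 \<le> u" "u \<le> 4" for u :: real
  proof (cases "Q = 1")
    case True
    have "P \<ge> 3"
    proof (rule ccontr)
      assume "\<not> P \<ge> 3"
      then have "P^2 \<le> 2^2" using P_pos by (intro power_mono) auto
      with D True show False by simp
    qed
    then have "(3::real)^2 \<le> of_int P ^ 2" by (intro power_mono) auto
    then show ?thesis using True u by simp
  next
    case False
    with \<open>Q > 0\<close> have Q: "real_of_int Q \<ge> 2" by linarith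
    \<comment> \<open>Then \<open>P^2 - u * Q \<ge> 1 + (4 - u) * Q\<close>, which for
      \<open>Q \<ge> 2\<close> is at least \<open>9 - 2 * u\<close>, the Mersenne value.\<close>
    have "P^2 - 4 * Q \<ge> 1" using D by simp
    then have "real_of_int (P^2 - 4 * Q) \<ge> 1" by linarith
    then have "of_int P ^ 2 \<ge> 1 + 4 * real_of_int Q" by simp
    moreover have "(4 - u) * (real_of_int Q - 2) \<ge> 0" using Q u by simp
    ultimately show ?thesis by (simp add: algebra_simps)
  qed
  then show ?thesis by (intro disjI1 ln_cyclotomic_mono) (auto simp: PQ)
next
  case False
  with \<open>Q \<noteq> 0\<close> have Q: "real_of_int Q \<le> - 1" by linarith
  have "real_of_int P \<ge> 1" using P_pos by simp
  then have P: "of_int P ^ 2 \<ge> (1::real)" using one_le_power by blast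
  have s: "sqrt 5 > (1::real)" "(1 + sqrt 5) / 2 * ((1 - sqrt 5) / 2) = (- 1 :: real)" by (simp_all add: algebra_simps)
  have "1 - u * (- 1) \<le> (of_int P)^2 - u * real_of_int Q" if "0 \<le> u" for u :: real
    using mult_left_mono[OF Q that] P by simp
  moreover have "(1 + sqrt 5) / 2 + (1 - sqrt 5) / 2 = (1::real)" by (simp add: field_simps)
  ultimately show ?thesis using s
    by (intro disjI2 ln_cyclotomic_mono) (auto simp: PQ)
qed

end

lemma carmichael:
  assumes D: "P^2 - 4 * Q > 0" and Q: "Q \<noteq> 0" and n: "n > 30"
  shows "has_primitive_prime_divisor U n"
proof (rule ccontr)
  assume prim: "\<not> has_primitive_prime_divisor U n"
  define d where "d = sqrt (real_of_int (P^2 - 4 * Q))"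
  define \<alpha> where "\<alpha> = (of_int P + d) / 2"
  define \<beta> where "\<beta> = (of_int P - d) / 2"
  have "real_of_int (P^2 - 4 * Q) > 0" using D by (simp only: of_int_0_less_iff)
  then have d: "d > 0" "d * d = of_int (P^2 - 4 * Q)"
    unfolding d_def by (simp_all only: real_sqrt_gt_zero real_sqrt_mult_self abs_of_pos)
  have PQ: "\<alpha> + \<beta> = of_int P" "\<alpha> * \<beta> = of_int Q" and lt: "\<beta> < \<alpha>"
    using d by (simp_all add: \<alpha>_def \<beta>_def field_simps power2_eq_square)
  let ?L = "ln_cyclotomic n \<alpha> \<beta>" and ?N = "totient n"
  \<comment> \<open>The ratio of the roots is \<open>1 / 2\<close>, and
    \<open>1 - 1 / 2 - 1 / 4 = 1 / 4\<close>.\<close>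
  have M: "ln_cyclotomic n 2 1 > real ?N * ln 2 + ln (1 / 4)"
    using ln_cyclotomic_gt[of n 2 1] n by (simp add: power2_eq_square)
  have s5: "sqrt 5 > (2.235::real)" "sqrt 5 < (2.237::real)"
    by (rule real_less_rsqrt, simp add: power2_eq_square, rule real_less_lsqrt, simp_all add: power2_eq_square)
  have phi: "sqrt 5 * sqrt 5 = (5::real)" by simp
  let ?a = "(1 + sqrt 5) / 2 :: real" and ?b = "(1 - sqrt 5) / 2 :: real"
  have ba: "?b / ?a = - ((3 - sqrt 5) / 2)" using s5 by (simp add: field_simps)
  have c: "1 - \<bar>?b / ?a\<bar> - (?b / ?a)^2 = 2 * sqrt 5 - 4"
    unfolding ba using s5 by (simp add: power2_eq_square field_simps)
  have F: "ln_cyclotomic n ?a ?b > real ?N * ln ?a + ln (2 * sqrt 5 - 4)"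
    using ln_cyclotomic_gt[of n ?a ?b] n s5 unfolding c by simp
  \<comment> \<open>Rational lower bounds: the golden ratio exceeds 1.617, and
    \<open>2 * sqrt 5 - 4\<close> is about 0.472.\<close>
  have F': "ln_cyclotomic n ?a ?b > real ?N * ln 1.617 + ln 0.47"
  proof -
    have "real ?N * ln 1.617 \<le> real ?N * ln ?a" using s5 by (intro mult_left_mono) auto
    moreover have "ln 0.47 \<le> ln (2 * sqrt 5 - 4)" using s5 by (subst ln_le_cancel_iff) auto
    ultimately show ?thesis using F by linarith
  qed
  have low: "?L > ln (2 ^ ?N / 4) \<or> ?L > ln (1.617 ^ ?N * 0.47)"
  proof -
    have "ln (2 ^ ?N / 4) = real ?N * ln 2 + ln (1 / 4)" by (simp add: ln_div ln_realpow)
    moreover have "ln (1.617 ^ ?N * 0.47) = real ?N * ln 1.617 + ln 0.47" by (subst ln_mult) (simp_all add: ln_realpow)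
    ultimately show ?thesis using ln_cyclotomic_ge[OF PQ lt D Q, of n] M F' by linarith
  qed
  have L: "?L = moebius_sum n (\<lambda>m. ln (real_of_int (U m)))"
    using n by (intro ln_cyclotomic_eq_moebius_sum_U PQ lt) auto
  from moebius_sum_ln_U_le[OF n prim] show False
  proof (elim disjE exE conjE)
    assume "moebius_sum n (\<lambda>m. ln (real_of_int (U m))) \<le> 0"
    then have "?L \<le> 0" by (simp add: L)
    moreover have N2: "?N \<ge> 2" using totient_gt_1[of n] n by simp
    then have "(2::real) ^ 2 \<le> 2 ^ ?N" "(1.617::real) ^ 2 \<le> 1.617 ^ ?N" by (intro power_increasing; simp)+
    then have "(2::real) ^ ?N / 4 \<ge> 1" "(1.617::real) ^ ?N * 0.47 \<ge> 1" by (simp_all add: power2_eq_square)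
    then have "ln ((2::real) ^ ?N / 4) \<ge> 0" "ln ((1.617::real) ^ ?N * 0.47) \<ge> 0" by (intro ln_ge_zero; simp)+
    ultimately show False using low by linarith
  next
    fix p k assume p: "prime p" "int p dvd U n" "k \<ge> 1" "n = apparition p * p ^ k"
      and le: "moebius_sum n (\<lambda>m. ln (real_of_int (U m))) \<le> ln (real p)"
    have Lp: "?L \<le> ln (real p)" unfolding L by (rule le)
    have r: "apparition p \<le> Suc p" using apparition_le_Suc[OF p(1) _ p(2)] n by simp
    note N = totient_ge_6[OF n r p(1) p(4,3)]
    \<comment> \<open>From \<open>N = 6\<close> on, both right sides are at least 7, so each step
      increases them by more than 1.\<close>
    have "real N + 1 \<le> 2 ^ N / 4 \<and> real N + 1 \<le> 1.617 ^ N * 0.47" if "N \<ge> 6" for N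
      using that
    proof (induction N rule: dec_induct)
      case base
      show ?case by (simp add: power_numeral_reduce)
    next
      case (step N)
      have "(1.617::real) ^ Suc N * 0.47 = 1.617 ^ N * 0.47 + 0.617 * (1.617 ^ N * 0.47)" by simp
      then show ?case using step by simp
    qed
    from this[OF N(1)] N(2) have "real p \<le> 2 ^ ?N / 4" "real p \<le> 1.617 ^ ?N * 0.47" by linarith+
    then have "ln (real p) \<le> ln (2 ^ ?N / 4)" "ln (real p) \<le> ln (1.617 ^ ?N * 0.47)"
      using prime_gt_0_nat[OF p(1)] by (subst ln_le_cancel_iff; simp)+
    with low Lp show False by linarith
  qed
qed

end

section \<open>Twisted Dirichlet series\<close>

text \<open>The modulus of \<open>x + y * cis \<theta>\<close> runs continuously from
  \<open>x + y\<close> at 0 to \<open>\<bar>x - y\<bar>\<close> at \<open>pi\<close>, hence takes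
  the value \<open>w\<close>.\<close>

lemma triangle_unit_complex:
  fixes x y w :: real
  assumes "0 \<le> x" "0 \<le> y" "0 \<le> w" "x \<le> y + w" "y \<le> x + w" "w \<le> x + y"
  obtains p q t :: complex where "norm p = 1" "norm q = 1" "norm t = 1"
    "of_real x * p + of_real y * q + of_real w * t = 0"
proof -
  let ?f = "\<lambda>\<theta>. norm (of_real x + of_real y * cis \<theta>)"
  have "\<exists>\<theta>\<ge>0. \<theta> \<le> pi \<and> ?f \<theta> = w"
  proof (rule IVT2')
    have "?f pi = \<bar>x - y\<bar>" by (simp flip: of_real_diff)
    then show "?f pi \<le> w" using assms by linarith
    have "?f 0 = \<bar>x + y\<bar>" by (simp flip: of_real_add)
    then show "w \<le> ?f 0" using assms by linarith
  qed (auto intro!: continuous_intros)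
  then obtain \<theta> where \<theta>: "?f \<theta> = w" by blast
  define z where "z = of_real x + of_real y * cis \<theta>"
  define t where "t = (if w = 0 then 1 else - z / of_real w)"
  have z: "norm z = w" using \<theta> by (simp add: z_def)
  have "norm t = 1" using z assms by (auto simp: t_def norm_divide)
  moreover have "of_real w * t = - z" using z by (auto simp: t_def)
  then have "of_real x * 1 + of_real y * cis \<theta> + of_real w * t = 0" by (simp add: z_def)
  ultimately show thesis using that[of 1 "cis \<theta>" t] by simp
qed

text \<open>Append \<open>|z|\<close> to the sides and cut the resulting sequence at half of its total length \<open>L\<close>:
  since no side exceeds \<open>L / 2\<close>, the part before the cut, the side cut, and the part after it
  are the sides of a triangle.\<close>

lemma infinite_polygon:
  fixes a :: "nat \<Rightarrow> real" and z :: complex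
  assumes nonneg: "\<And>n. a n \<ge> 0" and sum: "summable a"
    and up: "norm z \<le> suminf a" and low: "\<And>n. 2 * a n - suminf a \<le> norm z"
  obtains e :: "nat \<Rightarrow> complex" where "\<And>n. norm (e n) = 1" "z + (\<Sum>n. e n * of_real (a n)) = 0"
proof -
  define c where "c n = (case n of 0 \<Rightarrow> norm z | Suc m \<Rightarrow> a m)" for n
  have c_Suc: "c (Suc n) = a n" for n by (simp add: c_def)
  have c_0: "c 0 = norm z" by (simp add: c_def)
  have c_nonneg: "c n \<ge> 0" for n using nonneg by (cases n) (auto simp: c_def)
  have c_sum: "summable c" using sum by (subst summable_Suc_iff[symmetric]) (simp add: c_Suc)
  define L where "L = suminf c"
  have L: "L = norm z + suminf a" using suminf_split_head[OF c_sum] by (simp add: L_def c_Suc c_0)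
  have c_le: "c n \<le> L / 2" for n
    using up low nonneg by (cases n) (auto simp: c_def L field_simps)
  show thesis
  proof (cases "L = 0")
    case True
    have "suminf a \<ge> 0" using nonneg sum by (rule suminf_nonneg[rotated])
    moreover have "norm z + suminf a = 0" using True L by simp
    ultimately have "suminf a = 0" "norm z = 0" using norm_ge_zero[of z] by linarith+
    then have "a = (\<lambda>_. 0)" "z = 0" using suminf_eq_zero_iff[OF sum nonneg] by auto
    then show ?thesis using that[of "\<lambda>_. 1"] \<open>z = 0\<close> by simp
  next
    case False
    moreover have "L \<ge> 0" unfolding L_def using c_nonneg c_sum by (rule suminf_nonneg[rotated])
    ultimately have L0: "L > 0" by simp
    let ?s = "\<lambda>k. sum c {..<k}"
    have "?s \<longlonglongrightarrow> L" using summable_LIMSEQ[OF c_sum] by (simp add: L_def)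
    then have "eventually (\<lambda>k. ?s k > L / 2) sequentially" using L0 by (intro order_tendstoD) auto
    then have ex: "\<exists>k. ?s k \<ge> L / 2" using eventually_happens'[OF sequentially_bot] less_imp_le by blast
    define k where "k = (LEAST k. ?s k \<ge> L / 2)"
    have k: "?s k \<ge> L / 2" unfolding k_def using ex by (rule LeastI_ex)
    then have "k \<noteq> 0" using L0 by (cases k) auto
    then obtain j where j: "k = Suc j" by (cases k) auto
    have sj: "?s j < L / 2" using not_less_Least[of j "\<lambda>k. ?s k \<ge> L / 2"] j by (simp add: k_def)
    define w where "w = L - ?s k"
    have w: "w = (\<Sum>n. c (n + k))" unfolding w_def L_def by (simp add: suminf_minus_initial_segment[OF c_sum])
    have w0: "w \<ge> 0" unfolding w using c_nonneg c_sum by (intro suminf_nonneg summable_ignore_initial_segment)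
    have tot: "?s j + c j + w = L" by (simp add: w_def j)
    obtain p q t :: complex where pqt: "norm p = 1" "norm q = 1" "norm t = 1"
      "of_real (?s j) * p + of_real (c j) * q + of_real w * t = 0"
    proof (rule triangle_unit_complex)
      show "0 \<le> ?s j" using c_nonneg by (rule sum_nonneg)
      show "c j \<le> ?s j + w" using c_le[of j] tot by simp
      show "?s j \<le> c j + w" using sj tot by simp
      show "w \<le> ?s j + c j" using k tot unfolding w_def by simp
    qed (use c_nonneg w0 in auto)
    define \<phi> where "\<phi> i = (if i < j then p else if i = j then q else t)" for i
    have \<phi>: "norm (\<phi> i) = 1" for i using pqt by (simp add: \<phi>_def)
    have sum\<phi>: "(\<lambda>i. \<phi> i * of_real (c i)) sums 0"
    proof -
      have "(\<lambda>n. of_real (c (n + k))) sums (of_real w :: complex)"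
        using summable_sums[OF summable_ignore_initial_segment[OF c_sum, of k]] unfolding w by (rule sums_of_real)
      then have "(\<lambda>n. t * of_real (c (n + k))) sums (t * of_real w)" by (rule sums_mult)
      moreover have "\<phi> (n + k) = t" for n by (simp add: \<phi>_def j)
      ultimately have "(\<lambda>n. \<phi> (n + k) * of_real (c (n + k))) sums (t * of_real w)" by simp
      then have "(\<lambda>i. \<phi> i * of_real (c i)) sums (t * of_real w + (\<Sum>i<k. \<phi> i * of_real (c i)))"
        by (subst (asm) sums_iff_shift) simp
      also have "(\<Sum>i<k. \<phi> i * of_real (c i)) = p * of_real (?s j) + q * of_real (c j)"
        by (simp add: j \<phi>_def sum_distrib_left)
      also have "t * of_real w + \<dots> = 0" using pqt(4) by (simp add: algebra_simps)
      finally show ?thesis .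
    qed
    \<comment> \<open>A rotation of the closed polygon turns the side of length
      \<open>norm z\<close> into \<open>z\<close> itself; for \<open>z = 0\<close> any unit
      serves.\<close>
    define \<rho> where "\<rho> = (if z = 0 then 1 else sgn z / \<phi> 0)"
    have \<phi>0: "\<phi> 0 \<noteq> 0" using \<phi>[of 0] by force
    have \<rho>: "norm \<rho> = 1" using \<phi> by (simp add: \<rho>_def norm_divide norm_sgn)
    have \<rho>z: "\<rho> * (\<phi> 0 * of_real (c 0)) = z"
      using \<phi>0 by (simp add: \<rho>_def c_0 sgn_eq)
    have "(\<lambda>i. \<rho> * (\<phi> i * of_real (c i))) sums (\<rho> * 0)" using sum\<phi> by (rule sums_mult)
    then have "(\<lambda>i. \<rho> * (\<phi> (Suc i) * of_real (c (Suc i)))) sums (0 - z)"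
      using sums_Suc_iff[of "\<lambda>i. \<rho> * (\<phi> i * of_real (c i))" "- z"] \<rho>z by simp
    then have "(\<Sum>n. (\<rho> * \<phi> (Suc n)) * of_real (a n)) = - z"
      by (subst (asm) sums_iff) (simp add: mult.assoc c_Suc)
    then show ?thesis using that[of "\<lambda>n. \<rho> * \<phi> (Suc n)"] \<rho> \<phi> by (simp add: norm_mult)
  qed
qed

text \<open>The bound \<open>v n \<ge> 1\<close> makes the terms decrease in
  \<open>\<sigma>\<close>, so that the series at the left edge dominates on a half-plane. The locale
  is applied both to the whole sequence and to its tail.\<close>

locale dirichlet_frequencies =
  fixes v :: "nat \<Rightarrow> real"
  assumes v_ge_1: "v n \<ge> 1" and summable_v: "\<sigma> > 0 \<Longrightarrow> summable (\<lambda>n. v n powr (- \<sigma>))"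
begin

definition twisted :: "(nat \<Rightarrow> complex) \<Rightarrow> complex \<Rightarrow> complex" where
  "twisted g s = (\<Sum>n. g n * of_real (v n) powr (- s))"

lemma v_pos: "v n > 0"
  using v_ge_1[of n] by simp

lemma norm_v_powr: "norm (complex_of_real (v n) powr (- s)) = v n powr (- Re s)"
  using v_pos[of n] by (simp add: norm_powr_real_powr)

lemma v_powr_mono: "\<delta> \<le> \<sigma> \<Longrightarrow> v n powr (- \<sigma>) \<le> v n powr (- \<delta>)"
  using v_ge_1[of n] by (intro powr_mono) auto

lemma norm_twisted_term_le:
  assumes "norm (g n) \<le> B" "\<delta> \<le> Re s"
  shows "norm (g n * of_real (v n) powr (- s)) \<le> B * v n powr (- \<delta>)"
  unfolding norm_mult norm_v_powr
  using assms order_trans[OF norm_ge_zero assms(1)] by (intro mult_mono v_powr_mono) auto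

lemma summable_twisted:
  assumes "\<And>n. norm (g n) \<le> B" "Re s > 0"
  shows "summable (\<lambda>n. norm (g n * of_real (v n) powr (- s)))"
  using summable_mult[OF summable_v[OF assms(2)], of B]
  by (rule summable_comparison_test'[of _ 0]) (use norm_twisted_term_le assms in auto)

lemma twisted_holomorphic:
  assumes g: "\<And>n. norm (g n) \<le> 1"
  shows "twisted g holomorphic_on {s. Re s > 0}"
proof (rule holomorphic_uniform_sequence)
  show "open {s. 0 < Re s}" by (rule open_halfspace_Re_gt)
  show "(\<lambda>s. \<Sum>i<n. g i * of_real (v i) powr (- s)) holomorphic_on {s. 0 < Re s}" for n
    by (intro holomorphic_intros)
  fix x assume "x \<in> {s. 0 < Re s}"
  then have x: "Re x > 0" by simp
  define d where "d = Re x / 2"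
  have d: "d \<le> Re s" if "s \<in> cball x d" for s
    using abs_Re_le_cmod[of "x - s"] that by (simp add: dist_norm d_def)
  have "uniform_limit (cball x d) (\<lambda>n s. \<Sum>i<n. g i * of_real (v i) powr (- s))
      (\<lambda>s. \<Sum>i. g i * of_real (v i) powr (- s)) sequentially"
  proof (rule Weierstrass_m_test)
    show "summable (\<lambda>n. v n powr (- d))" using x by (intro summable_v) (simp add: d_def)
    show "norm (g n * of_real (v n) powr (- s)) \<le> v n powr (- d)" if "s \<in> cball x d" for n s
      using norm_twisted_term_le[of g n 1 d s] g d[OF that] by simp
  qed
  then have "uniform_limit (cball x d) (\<lambda>n s. \<Sum>i<n. g i * of_real (v i) powr (- s)) (twisted g) sequentially"
    by (simp add: twisted_def[abs_def])
  moreover have "d > 0" using x by (simp add: d_def)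
  moreover have "cball x d \<subseteq> {s. 0 < Re s}" using d \<open>d > 0\<close> by force
  ultimately show "\<exists>d>0. cball x d \<subseteq> {s. 0 < Re s} \<and>
      uniform_limit (cball x d) (\<lambda>n s. \<Sum>i<n. g i * of_real (v i) powr (- s)) (twisted g) sequentially"
    by blast
qed

text \<open>Dominated convergence at the leftmost abscissa \<open>\<delta>\<close> of
  \<open>K\<close>: the difference is bounded on all of \<open>K\<close> by one series in
  \<open>v n powr (- \<delta>)\<close>, to which Tannery's theorem applies.\<close>

lemma twisted_uniform_limit:
  assumes h: "\<And>k n. norm (h k n) \<le> 1" and lim: "\<And>n. (\<lambda>k. h k n) \<longlonglongrightarrow> g n"
    and K: "compact K" "K \<subseteq> {s. Re s > 0}"
  shows "uniform_limit K (\<lambda>k. twisted (h k)) (twisted g) sequentially"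
proof (cases "K = {}")
  case False
  obtain s0 where s0: "s0 \<in> K" "\<And>s. s \<in> K \<Longrightarrow> Re s0 \<le> Re s"
    using continuous_attains_inf[OF K(1) False continuous_on_Re[OF continuous_on_id]] by blast
  define \<delta> where "\<delta> = Re s0"
  have \<delta>: "\<delta> > 0" using s0 K by (auto simp: \<delta>_def)
  have g: "norm (g n) \<le> 1" for n
    using tendsto_norm[OF lim[of n]] by (rule LIMSEQ_le_const2) (use h in auto)
  have sum: "summable (\<lambda>n. norm (h k n - g n) * v n powr (- \<delta>))" for k
  proof (rule summable_comparison_test'[of _ 0])
    show "summable (\<lambda>n. 2 * v n powr (- \<delta>))" using \<delta> by (intro summable_mult summable_v)
    show "norm (norm (h k n - g n) * v n powr (- \<delta>)) \<le> 2 * v n powr (- \<delta>)" for n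
      using norm_triangle_ineq4[of "h k n" "g n"] h[of k n] g[of n] by (simp add: mult_right_mono)
  qed
  have "(\<lambda>k. \<Sum>n. norm (h k n - g n) * v n powr (- \<delta>)) \<longlonglongrightarrow> (\<Sum>n. 0 :: real)"
  proof (rule conjunct2[OF conjunct2[OF tannerys_theorem]])
    show "(\<lambda>k. norm (h k n - g n) * v n powr (- \<delta>)) \<longlonglongrightarrow> 0" for n
      by (intro tendsto_mult_left_zero tendsto_norm_zero LIM_zero lim)
    show "summable (\<lambda>n. 2 * v n powr (- \<delta>))" using \<delta> by (intro summable_mult summable_v)
    show "\<forall>\<^sub>F (n, k) in sequentially \<times>\<^sub>F sequentially.
        norm (norm (h k n - g n) * v n powr (- \<delta>)) \<le> 2 * v n powr (- \<delta>)"
    proof (rule always_eventually, clarify)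
      fix n k
      show "norm (norm (h k n - g n) * v n powr (- \<delta>)) \<le> 2 * v n powr (- \<delta>)"
        using norm_triangle_ineq4[of "h k n" "g n"] h[of k n] g[of n] by (simp add: mult_right_mono)
    qed
  qed simp
  then have lim0: "(\<lambda>k. \<Sum>n. norm (h k n - g n) * v n powr (- \<delta>)) \<longlonglongrightarrow> 0" by simp
  have le: "dist (twisted (h k) s) (twisted g s) \<le> (\<Sum>n. norm (h k n - g n) * v n powr (- \<delta>))"
    if s: "s \<in> K" for k s
  proof -
    have s': "Re s > 0" "\<delta> \<le> Re s" using s K s0 by (auto simp: \<delta>_def)
    note summ = summable_norm_cancel[OF summable_twisted]
    have "twisted (h k) s - twisted g s = (\<Sum>n. (h k n - g n) * of_real (v n) powr (- s))"
      using suminf_diff[OF summ[of "h k", OF h s'(1)] summ[of g, OF g s'(1)]]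
      unfolding twisted_def left_diff_distrib by simp
    also have "norm \<dots> \<le> (\<Sum>n. norm (h k n - g n) * v n powr (- \<delta>))"
    proof (rule norm_suminf_le)
      show "norm ((h k n - g n) * of_real (v n) powr (- s)) \<le> norm (h k n - g n) * v n powr (- \<delta>)" for n
        using s' by (intro norm_twisted_term_le) auto
    qed (rule sum)
    finally show ?thesis by (simp add: dist_norm)
  qed
  show ?thesis
  proof (rule uniform_limitI)
    fix e :: real assume "e > 0"
    with lim0 have "eventually (\<lambda>k. (\<Sum>n. norm (h k n - g n) * v n powr (- \<delta>)) < e) sequentially"
      by (rule order_tendstoD)
    then show "\<forall>\<^sub>F k in sequentially. \<forall>s\<in>K. dist (twisted (h k) s) (twisted g s) < e"
      by eventually_elim (use le in \<open>auto intro: le_less_trans\<close>)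
  qed
qed simp

text \<open>As \<open>x\<close> tends to infinity, terms with \<open>v n > 1\<close> disappear and
  each term with \<open>v n = 1\<close> contributes 1, so the limit is at least 1.\<close>

lemma twisted_nonzero:
  assumes g: "\<And>n. norm (g n) \<le> 1" and one: "\<And>n. v n = 1 \<Longrightarrow> g n = 1" and v0: "v 0 = 1"
  obtains x :: real where "x > 0" "twisted g (of_real x) \<noteq> 0"
proof -
  let ?b = "\<lambda>n. of_bool (v n = 1) :: complex"
  have "summable (\<lambda>n. norm (?b n)) \<and> (\<lambda>k. \<Sum>n. g n * of_real (v n) powr (- of_real (real (Suc k)))) \<longlonglongrightarrow> suminf ?b"
  proof (rule conjunct2[OF tannerys_theorem])
    fix n
    show "(\<lambda>k. g n * of_real (v n) powr (- of_real (real (Suc k)))) \<longlonglongrightarrow> ?b n"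
    proof (cases "v n = 1")
      case True
      then show ?thesis using one by simp
    next
      case False
      then have "v n > 1" using v_ge_1[of n] by simp
      then have "(\<lambda>k. inverse (v n) ^ Suc k) \<longlonglongrightarrow> 0"
        by (intro LIMSEQ_Suc LIMSEQ_realpow_zero) (auto simp: inverse_less_1_iff)
      moreover have "inverse (v n) ^ Suc k = v n powr (- real (Suc k))" for k
        using v_pos[of n] by (simp only: powr_minus powr_realpow power_inverse)
      ultimately have "(\<lambda>k. v n powr (- real (Suc k))) \<longlonglongrightarrow> 0" by simp
      then have "(\<lambda>k. g n * of_real (v n powr (- real (Suc k)))) \<longlonglongrightarrow> g n * of_real 0"
        by (intro tendsto_intros)
      then show ?thesis using False v_pos[of n] by (simp add: powr_of_real[symmetric] del: of_nat_Suc)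
    qed
  next
    show "summable (\<lambda>n. v n powr (- 1))" by (rule summable_v) simp
    show "\<forall>\<^sub>F (n, k) in sequentially \<times>\<^sub>F sequentially.
        norm (g n * of_real (v n) powr (- of_real (real (Suc k)))) \<le> v n powr (- 1)"
    proof (rule always_eventually, clarify)
      fix n k
      show "norm (g n * of_real (v n) powr (- of_real (real (Suc k)))) \<le> v n powr (- 1)"
        using norm_twisted_term_le[of g n 1 1 "of_real (real (Suc k))"] g by simp
    qed
  qed simp
  then have sb: "summable ?b" and lim: "(\<lambda>k. twisted g (of_real (real (Suc k)))) \<longlonglongrightarrow> suminf ?b"
    by (auto simp: twisted_def intro: summable_norm_cancel)
  have "suminf ?b \<noteq> 0"
  proof -
    have "summable (\<lambda>n. Re (?b n))" using sb by (rule summable_Re)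
    then have "(\<Sum>n\<in>{0}. Re (?b n)) \<le> (\<Sum>n. Re (?b n))" by (rule sum_le_suminf) auto
    also have "\<dots> = Re (suminf ?b)" using sb by (rule Re_suminf[symmetric])
    finally show ?thesis using v0 by auto
  qed
  then have "eventually (\<lambda>k. twisted g (of_real (real (Suc k))) \<noteq> 0) sequentially"
    using lim by (rule tendsto_imp_eventually_ne[rotated])
  then obtain k where "twisted g (of_real (real (Suc k))) \<noteq> 0"
    using eventually_happens'[OF sequentially_bot] by blast
  then show thesis using that[of "real (Suc k)"] by simp
qed

text \<open>Vertical translates of a series are twists of it; by Hurwitz' theorem a zero of a limit of
  vertical translates is approached by zeros of the series itself.\<close>

lemma zero_of_translates:
  assumes g: "\<And>n. norm (g n) \<le> 1" and one: "\<And>n. v n = 1 \<Longrightarrow> g n = 1" and v0: "v 0 = 1"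
    and lim: "\<And>n. (\<lambda>k. cis (- t k * ln (v n))) \<longlonglongrightarrow> g n"
    and \<sigma>: "\<sigma> > 0" and zero: "twisted g (of_real \<sigma>) = 0" and e: "e > 0"
  shows "\<exists>\<rho>. Re \<rho> > 0 \<and> \<bar>Re \<rho> - \<sigma>\<bar> < e \<and> twisted (\<lambda>_. 1) \<rho> = 0"
proof (rule ccontr)
  assume no: "\<not> ?thesis"
  define d where "d = min e \<sigma>"
  have d: "d > 0" "d \<le> e" "d \<le> \<sigma>" using e \<sigma> by (auto simp: d_def)
  let ?S = "ball (complex_of_real \<sigma>) d"
  have re: "\<bar>Re s - \<sigma>\<bar> < d" if "s \<in> ?S" for s
    using abs_Re_le_cmod[of "of_real \<sigma> - s"] that by (simp add: dist_norm)
  have sub: "?S \<subseteq> {s. Re s > 0}" using re d by force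
  let ?h = "\<lambda>k n. cis (- t k * ln (v n))"
  have trans: "twisted (?h k) s = twisted (\<lambda>_. 1) (s + \<i> * of_real (t k))" for k s
  proof -
    have "?h k n * of_real (v n) powr (- s) = of_real (v n) powr (- (s + \<i> * of_real (t k)))" for n
      using v_pos[of n] by (simp add: powr_def cis_conv_exp Ln_of_real exp_add[symmetric] algebra_simps)
    then show ?thesis by (simp add: twisted_def)
  qed
  have "twisted g (of_real \<sigma>) \<noteq> 0"
  proof (rule Hurwitz_no_zeros[of ?S "\<lambda>k. twisted (?h k)" "twisted g"])
    show "twisted (?h k) holomorphic_on ?S" for k
      using sub by (intro holomorphic_on_subset[OF twisted_holomorphic]) auto
    show "twisted g holomorphic_on ?S"
      using sub g by (intro holomorphic_on_subset[OF twisted_holomorphic]) auto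
    show "uniform_limit K (\<lambda>k. twisted (?h k)) (twisted g) sequentially" if "compact K" "K \<subseteq> ?S" for K
      using that sub lim by (intro twisted_uniform_limit) auto
    show "twisted (?h k) s \<noteq> 0" if "s \<in> ?S" for k s
    proof
      assume "twisted (?h k) s = 0"
      then have "twisted (\<lambda>_. 1) (s + \<i> * of_real (t k)) = 0" by (simp only: trans)
      moreover have "Re (s + \<i> * of_real (t k)) > 0" "\<bar>Re (s + \<i> * of_real (t k)) - \<sigma>\<bar> < e"
        using re[OF that] d by auto
      ultimately show False using no by blast
    qed
    \<comment> \<open>A constant value would be 0, the value at \<open>\<sigma>\<close>; analytic
      continuation then makes the series vanish on the whole half-plane, against
      \<open>twisted_nonzero\<close>.\<close>
    show "\<not> twisted g constant_on ?S"
    proof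
      assume "twisted g constant_on ?S"
      then have z: "twisted g s = 0" if "s \<in> ?S" for s
      proof -
        obtain c where "\<And>x. x \<in> ?S \<Longrightarrow> twisted g x = c"
          using \<open>twisted g constant_on ?S\<close> unfolding constant_on_def by blast
        from this[OF that] this[of "of_real \<sigma>"] zero d show ?thesis by simp
      qed
      have all: "twisted g s = 0" if "s \<in> {s. Re s > 0}" for s
      proof (rule analytic_continuation_open[of ?S "{s. Re s > 0}" "twisted g" "\<lambda>_. 0"])
        show "connected {s. 0 < Re s}" by (intro convex_connected convex_halfspace_Re_gt)
      qed (use that sub z d g in \<open>auto intro: twisted_holomorphic open_halfspace_Re_gt\<close>)
      obtain x :: real where "x > 0" "twisted g (of_real x) \<noteq> 0" using twisted_nonzero[OF g one v0] .
      then show False using all[of "of_real x"] by simp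
    qed
  qed (use d in auto)
  with zero show False by simp
qed

end

section \<open>Kronecker approximation and the torus\<close>

text \<open>Separating positive and negative coefficients gives two integers with equal logarithms.
  They are equal, and unique factorization forces \<open>nat (k q) = nat (- k q)\<close>.\<close>

lemma ln_primes_independent:
  fixes W :: "int set" and k :: "int \<Rightarrow> int"
  assumes fin: "finite W" and prime: "\<And>p. p \<in> W \<Longrightarrow> prime p"
    and sum: "(\<Sum>p\<in>W. of_int (k p) * ln (real_of_int p)) = 0" and q: "q \<in> W"
  shows "k q = 0"
proof -
  have pos: "real_of_int p > 0" if "p \<in> W" for p using prime[OF that] prime_gt_0_int by simp
  have ln_prod_power: "ln (real_of_int (\<Prod>p\<in>W. p ^ f p)) = (\<Sum>p\<in>W. real (f p) * ln (real_of_int p))" for f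
  proof -
    have "ln (real_of_int (\<Prod>p\<in>W. p ^ f p)) = ln (\<Prod>p\<in>W. real_of_int p ^ f p)" by simp
    also have "\<dots> = (\<Sum>p\<in>W. ln (real_of_int p ^ f p))" using pos by (intro ln_prod) (auto simp: fin)
    finally show ?thesis by (simp add: ln_realpow)
  qed
  let ?A = "\<Prod>p\<in>W. p ^ nat (k p)" and ?B = "\<Prod>p\<in>W. p ^ nat (- k p)"
  have gt0: "real_of_int (\<Prod>p\<in>W. p ^ f p) > 0" for f :: "int \<Rightarrow> nat"
    using pos by (auto intro!: prod_pos)
  have "ln (real_of_int ?A) - ln (real_of_int ?B) = (\<Sum>p\<in>W. of_int (k p) * ln (real_of_int p))"
    unfolding ln_prod_power sum_subtractf[symmetric] left_diff_distrib[symmetric]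
  proof (intro sum.cong refl)
    fix p
    have "real (nat (k p)) - real (nat (- k p)) = of_int (k p)" by (cases "k p \<ge> 0") auto
    then show "(real (nat (k p)) - real (nat (- k p))) * ln (real_of_int p) = of_int (k p) * ln (real_of_int p)"
      by simp
  qed
  then have "ln (real_of_int ?A) = ln (real_of_int ?B)" using sum by simp
  then have "?A = ?B" using gt0[of "\<lambda>p. nat (k p)"] gt0[of "\<lambda>p. nat (- k p)"]
    by (simp only: ln_inj_iff of_int_eq_iff)
  then have "multiplicity q ?A = multiplicity q ?B" by simp
  then have "nat (k q) = nat (- k q)"
    using q prime fin by (simp add: multiplicity_prod_prime_powers)
  then show ?thesis by simp
qed

lemma norm_cis_diff_le: "norm (cis x - cis y) \<le> \<bar>x - y\<bar>"
proof -
  have "cis x - cis y = cis y * (cis (x - y) - 1)"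
    by (simp add: algebra_simps cis_mult)
  then have "norm (cis x - cis y) = norm (cis (x - y) - 1)" by (simp add: norm_mult)
  also have "\<dots> \<le> \<bar>x - y\<bar>"
  proof -
    have "norm (cis (x - y) - 1) = 2 * \<bar>sin ((x - y) / 2)\<bar>"
      using dist_exp_i_1[of "x - y"] by (simp add: cis_conv_exp)
    also have "\<dots> \<le> \<bar>x - y\<bar>" using abs_sin_x_le_abs_x[of "(x - y) / 2"] by simp
    finally show ?thesis .
  qed
  finally show ?thesis .
qed

lemma kronecker_primes:
  fixes W :: "int set" and \<omega> :: "int \<Rightarrow> complex"
  assumes fin: "finite W" and prime: "\<And>p. p \<in> W \<Longrightarrow> prime p"
    and \<omega>: "\<And>p. p \<in> W \<Longrightarrow> norm (\<omega> p) = 1" and \<delta>: "\<delta> > 0"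
  obtains t where "\<And>p. p \<in> W \<Longrightarrow> norm (cis (t * ln (real_of_int p)) - \<omega> p) < \<delta>"
proof -
  obtain f where f: "bij_betw f {..<card W} W"
    using ex_bij_betw_nat_finite[OF fin] by (auto simp: atLeast0LessThan)
  define n where "n = card W"
  define \<theta> where "\<theta> i = ln (real_of_int (f i))" for i
  have fim: "f ` {..<n} = W" using f by (simp add: n_def bij_betw_def)
  have fW: "f i \<in> W" if "i < n" for i using f that by (auto simp: n_def bij_betw_def)
  have pos: "real_of_int p > 0" if "p \<in> W" for p using prime[OF that] prime_gt_0_int by simp
  have inj_ln: "inj_on (\<lambda>p. ln (real_of_int p)) W"
    using pos by (auto intro!: inj_onI simp: ln_inj_iff)
  have inj: "inj_on \<theta> {..<n}"
    using comp_inj_on[OF bij_betw_imp_inj_on[OF f] inj_on_subset[OF inj_ln]] f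
    by (simp add: \<theta>_def[abs_def] o_def n_def bij_betw_def)
  \<comment> \<open>Independence in Kronecker's theorem is over the integers, acting on the reals
    through \<open>real_of_int\<close>.\<close>
  interpret M: Modules.module "\<lambda>r. (*) (real_of_int r)"
    by unfold_locales (simp_all add: algebra_simps)
  have indep: "module.independent (\<lambda>r. (*) (real_of_int r)) (\<theta> ` {..<n})"
    unfolding M.dependent_explicit
  proof clarify
    fix t u v
    assume t: "finite t" "t \<subseteq> \<theta> ` {..<n}" "(\<Sum>v\<in>t. real_of_int (u v) * v) = 0" "v \<in> t" "u v \<noteq> 0"
    have img: "\<theta> ` {..<n} = (\<lambda>p. ln (real_of_int p)) ` W"
      by (simp add: \<theta>_def image_image flip: fim)
    define W' where "W' = {p\<in>W. ln (real_of_int p) \<in> t}"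
    have t_eq: "t = (\<lambda>p. ln (real_of_int p)) ` W'" using t(2) img by (auto simp: W'_def)
    have inj': "inj_on (\<lambda>p. ln (real_of_int p)) W'" using inj_ln by (rule inj_on_subset) (auto simp: W'_def)
    obtain q where q: "q \<in> W'" "v = ln (real_of_int q)" using t(4) t_eq by blast
    have "(\<Sum>p\<in>W'. of_int (u (ln (real_of_int p))) * ln (real_of_int p)) = 0"
      using t(3) unfolding t_eq by (simp add: sum.reindex[OF inj'])
    then have "u (ln (real_of_int q)) = 0"
      using fin prime q(1) by (intro ln_primes_independent[of W']) (auto simp: W'_def)
    with t(5) q(2) show False by simp
  qed
  \<comment> \<open>Phases are measured in turns: an error of \<open>\<delta> / (2 * pi)\<close>
    turns is \<open>\<delta>\<close> in radians, and the time found below is multiplied by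
    \<open>2 * pi\<close>.\<close>
  define \<alpha> where "\<alpha> i = Arg (\<omega> (f i)) / (2 * pi)" for i
  obtain t h where th: "\<And>i. i < n \<Longrightarrow> \<bar>t * \<theta> i - of_int (h i) - \<alpha> i\<bar> < \<delta> / (2 * pi)"
    using Kronecker_thm_1[OF indep inj, of "\<delta> / (2 * pi)" \<alpha>] \<delta> by auto
  show thesis
  proof
    fix p assume p: "p \<in> W"
    then obtain i where i: "i < n" "p = f i" using f by (auto simp: n_def bij_betw_def)
    have w: "\<omega> p = cis (2 * pi * (of_int (h i) + \<alpha> i))"
    proof -
      have "cis (2 * pi * (of_int (h i) + \<alpha> i)) = cis (2 * pi * of_int (h i)) * cis (2 * pi * \<alpha> i)"
        by (simp only: cis_mult distrib_left)
      also have "cis (2 * pi * of_int (h i)) = 1" by (rule cis_multiple_2pi) simp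
      also have "cis (2 * pi * \<alpha> i) = \<omega> p"
      proof -
        have "\<omega> p \<noteq> 0" using \<omega>[OF p] by force
        then show ?thesis using \<omega>[OF p] cis_Arg[of "\<omega> p"] by (simp add: \<alpha>_def sgn_eq flip: i(2))
      qed
      finally show ?thesis by (metis mult_1)
    qed
    have "norm (cis (2 * pi * t * ln (real_of_int p)) - \<omega> p)
        \<le> \<bar>2 * pi * t * ln (real_of_int p) - 2 * pi * (of_int (h i) + \<alpha> i)\<bar>"
      unfolding w by (rule norm_cis_diff_le)
    also have "2 * pi * t * ln (real_of_int p) - 2 * pi * (of_int (h i) + \<alpha> i) =
        (2 * pi) * (t * \<theta> i - of_int (h i) - \<alpha> i)"
      by (simp add: \<theta>_def i algebra_simps)
    also have "\<bar>\<dots>\<bar> = 2 * pi * \<bar>t * \<theta> i - of_int (h i) - \<alpha> i\<bar>"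
      by (simp add: abs_mult)
    also have "\<dots> < \<delta>" using th[OF i(1)] by (simp add: field_simps)
    finally show "norm (cis (2 * pi * t * ln (real_of_int p)) - \<omega> p) < \<delta>" .
  qed
qed

text \<open>The completely multiplicative extension of \<open>\<omega>\<close>. In contrast to
  \<open>C\<close>, the product runs over the primes of \<open>m\<close> itself, so one
  \<open>\<omega>\<close> serves all terms of the sequence.\<close>

definition character :: "(int \<Rightarrow> complex) \<Rightarrow> int \<Rightarrow> complex" where
  "character \<omega> m = (\<Prod>p\<in>prime_factors m. \<omega> p ^ multiplicity p m)"

lemma norm_character: "(\<And>p. prime p \<Longrightarrow> norm (\<omega> p) = 1) \<Longrightarrow> norm (character \<omega> m) = 1"
  unfolding character_def prod_norm[symmetric] by (intro prod.neutral ballI) (metis in_prime_factors_imp_prime norm_power power_one)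

lemma character_eq_prod:
  assumes "finite V" "prime_factors m \<subseteq> V" "\<And>p. p \<in> V \<Longrightarrow> prime p"
  shows "character \<omega> m = (\<Prod>p\<in>V. \<omega> p ^ multiplicity p m)"
  unfolding character_def using assms
  by (intro prod.mono_neutral_left) (auto simp: prime_factors_multiplicity)

lemma character_cong:
  "(\<And>p. prime p \<Longrightarrow> p dvd m \<Longrightarrow> \<omega> p = \<omega>' p) \<Longrightarrow> character \<omega> m = character \<omega>' m"
  unfolding character_def
  by (intro prod.cong refl) (metis in_prime_factors_imp_prime in_prime_factors_imp_dvd)

text \<open>This identifies vertical translation with a twist: \<open>p ^ (i t)\<close> on primes
  extends to \<open>m ^ (i t)\<close>.\<close>

lemma character_cis:
  assumes "m > 0"
  shows "character (\<lambda>p. cis (t * ln (real_of_int p))) m = cis (t * ln (real_of_int m))"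
proof -
  have pos: "real_of_int p > 0" if "p \<in> prime_factors m" for p
    using that prime_gt_0_int by force
  have "real_of_int m = real_of_int (\<Prod>p\<in>prime_factors m. p ^ multiplicity p m)"
    using assms by (subst prod_prime_factors) auto
  then have "ln (real_of_int m) = ln (\<Prod>p\<in>prime_factors m. real_of_int p ^ multiplicity p m)"
    by simp
  also have "\<dots> = (\<Sum>p\<in>prime_factors m. ln (real_of_int p ^ multiplicity p m))"
    using pos by (intro ln_prod) auto
  finally have ln: "ln (real_of_int m) = (\<Sum>p\<in>prime_factors m. real (multiplicity p m) * ln (real_of_int p))"
    by (simp add: ln_realpow)
  have "cis (t * ln (real_of_int m)) = (\<Prod>p\<in>prime_factors m. cis (t * (real (multiplicity p m) * ln (real_of_int p))))"
    unfolding ln sum_distrib_left by (induction rule: infinite_finite_induct) (auto simp: cis_mult[symmetric]) 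
  also have "\<dots> = character (\<lambda>p. cis (t * ln (real_of_int p))) m"
    unfolding character_def by (intro prod.cong refl) (simp add: Complex.DeMoivre mult.left_commute)
  finally show ?thesis ..
qed

text \<open>A character value is continuous in finitely many prime phases. Approximating these with
  errors \<open>1 / (j + 1)\<close> and passing to the limit avoids an explicit modulus of
  continuity.\<close>

lemma kronecker_character:
  fixes M :: "int set"
  assumes fin: "finite M" and pos: "\<And>m. m \<in> M \<Longrightarrow> m > 0"
    and \<omega>: "\<And>p. prime p \<Longrightarrow> norm (\<omega> p) = 1" and e: "e > 0"
  obtains t where "\<And>m. m \<in> M \<Longrightarrow> norm (cis (t * ln (real_of_int m)) - character \<omega> m) < e"
proof -
  define W where "W = (\<Union>m\<in>M. prime_factors m)"
  have W: "finite W" "\<And>p. p \<in> W \<Longrightarrow> prime p" using fin by (auto simp: W_def)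
  have "\<exists>t. \<forall>p\<in>W. norm (cis (t * ln (real_of_int p)) - \<omega> p) < inverse (real (Suc j))" for j
    using kronecker_primes[OF W, of \<omega> "inverse (real (Suc j))"] \<omega> W by (metis inverse_positive_iff_positive of_nat_0_less_iff zero_less_Suc)
  then obtain t where t: "\<And>j p. p \<in> W \<Longrightarrow> norm (cis (t j * ln (real_of_int p)) - \<omega> p) < inverse (real (Suc j))"
    by metis
  have lim: "(\<lambda>j. cis (t j * ln (real_of_int p))) \<longlonglongrightarrow> \<omega> p" if "p \<in> W" for p
  proof (rule LIM_zero_cancel, rule Lim_null_comparison)
    show "\<forall>\<^sub>F j in sequentially. norm (cis (t j * ln (real_of_int p)) - \<omega> p) \<le> inverse (real (Suc j))"
      using t[OF that] by (intro always_eventually) (auto intro: less_imp_le)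
  qed (rule LIMSEQ_inverse_real_of_nat)
  have "(\<lambda>j. cis (t j * ln (real_of_int m))) \<longlonglongrightarrow> character \<omega> m" if "m \<in> M" for m
  proof -
    have "(\<lambda>j. \<Prod>p\<in>prime_factors m. cis (t j * ln (real_of_int p)) ^ multiplicity p m) \<longlonglongrightarrow> character \<omega> m"
      unfolding character_def using that by (intro tendsto_prod tendsto_power lim) (auto simp: W_def)
    then show ?thesis using character_cis[OF pos[OF that]] by (simp add: character_def)
  qed
  then have "\<forall>\<^sub>F j in sequentially. dist (cis (t j * ln (real_of_int m))) (character \<omega> m) < e" if "m \<in> M" for m
    using that e by (intro tendstoD) auto
  then have "\<forall>\<^sub>F j in sequentially. \<forall>m\<in>M. dist (cis (t j * ln (real_of_int m))) (character \<omega> m) < e"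
    using fin by (intro eventually_ball_finite) auto
  then obtain j where "\<forall>m\<in>M. dist (cis (t j * ln (real_of_int m))) (character \<omega> m) < e"
    using eventually_happens'[OF sequentially_bot] by blast
  then show thesis using that[of "t j"] by (simp add: dist_norm)
qed

text \<open>The prime \<open>p\<close> may divide \<open>m\<close> to a power \<open>k > 1\<close>;
  the new phase is a \<open>k\<close>-th root of the required unit number.\<close>

lemma character_update:
  assumes p: "prime p" "p dvd m" and m: "m \<noteq> 0" and \<omega>: "\<And>p. prime p \<Longrightarrow> norm (\<omega> p) = 1" and w: "norm w = 1"
  obtains y where "norm y = 1" "character (fun_upd \<omega> p y) m = w"
proof -
  let ?F = "prime_factors m - {p}"
  have pm: "p \<in> prime_factors m" using p m by (auto simp: in_prime_factors_iff)
  define B where "B = (\<Prod>q\<in>?F. \<omega> q ^ multiplicity q m)"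
  have B: "norm B = 1"
    unfolding B_def prod_norm[symmetric] using \<omega>
    by (intro prod.neutral ballI) (metis DiffD1 in_prime_factors_imp_prime norm_power power_one)
  then have B0: "B \<noteq> 0" by force
  define k where "k = multiplicity p m"
  have k: "k > 0" using pm by (simp add: k_def prime_factors_multiplicity)
  define y where "y = cis (Arg (w / B) / real k)"
  have "y ^ k = cis (Arg (w / B))" using k by (simp add: y_def Complex.DeMoivre)
  also have "\<dots> = w / B" using B w B0 by (subst cis_Arg) (auto simp: sgn_eq norm_divide)
  finally have y: "y ^ k = w / B" .
  have "character (fun_upd \<omega> p y) m = (fun_upd \<omega> p y) p ^ multiplicity p m * (\<Prod>q\<in>?F. (fun_upd \<omega> p y) q ^ multiplicity q m)"
    unfolding character_def by (subst prod.remove[OF _ pm]) auto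
  also have "(\<Prod>q\<in>?F. (fun_upd \<omega> p y) q ^ multiplicity q m) = B"
    unfolding B_def by (intro prod.cong) auto
  finally have "character (fun_upd \<omega> p y) m = y ^ k * B" by (simp only: fun_upd_same k_def)
  also have "\<dots> = w" using y B0 by simp
  finally have "character (fun_upd \<omega> p y) m = w" .
  moreover have "norm y = 1" by (simp add: y_def)
  ultimately show thesis using that by blast
qed

text \<open>Elements of the torus are \<open>undefined\<close> off \<open>prime_set U N\<close>, so
  it is a product over all integers of circles and singletons, all connected.\<close>

lemma connected_torus: "connected (torus U N)"
proof -
  have "torus U N = (\<Pi>\<^sub>E p\<in>UNIV. if p \<in> prime_set U N then sphere 0 1 else {undefined})"
    by (fastforce simp: torus_def PiE_iff extensional_def split: if_splits)
  moreover have "connectedin (product_topology (\<lambda>_. euclidean) UNIV)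
     (\<Pi>\<^sub>E p\<in>UNIV. if p \<in> prime_set U N then sphere 0 1 else {undefined :: complex})"
    by (subst connectedin_PiE) (auto intro: connected_sphere)
  ultimately show ?thesis
    by (simp add: euclidean_product_topology)
qed

lemma norm_C_intermediate:
  assumes "m_min U N \<sigma> \<le> r" "r \<le> M_max U N \<sigma>"
  obtains \<omega> where "\<omega> \<in> torus U N" "norm (C U N \<sigma> \<omega>) = r"
proof -
  let ?S = "(\<lambda>\<omega>. norm (C U N \<sigma> \<omega>)) ` torus U N"
  have "connected ?S" by (intro connected_continuous_image continuous_on_norm_C connected_torus)
  moreover have "m_min U N \<sigma> \<in> ?S" "M_max U N \<sigma> \<in> ?S"
    using m_min_attained(1) M_max_attained(1) by blast+
  ultimately have "{m_min U N \<sigma>..M_max U N \<sigma>} \<subseteq> ?S" by (rule connected_contains_Icc)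
  then have "r \<in> ?S" using assms by (meson atLeastAtMost_iff subsetD)
  then show thesis using that by blast
qed

lemma infsum_atLeast_eq_suminf:
  fixes f :: "nat \<Rightarrow> 'a :: banach"
  assumes "summable (\<lambda>n. norm (f (n + k)))"
  shows "infsum f {k..} = (\<Sum>n. f (n + k))"
proof -
  have "{k..} = (\<lambda>n. n + k) ` UNIV"
    by (auto simp: image_iff) (metis le_add_diff_inverse2)
  then have "infsum f {k..} = infsum (\<lambda>n. f (n + k)) UNIV"
    by (simp add: infsum_reindex o_def)
  also have "\<dots> = (\<Sum>n. f (n + k))"
    using norm_summable_imp_has_sum[OF assms summable_sums[OF summable_norm_cancel[OF assms]]]
    by (rule infsumI)
  finally show ?thesis .
qed

section \<open>Real parts of the zeros\<close>

locale growing_lucas = lucas +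
  assumes growth: "exponential_growth U"
begin

abbreviation u :: "nat \<Rightarrow> real" where "u n \<equiv> real_of_int (U n)"

lemma u_pos: "n \<ge> 1 \<Longrightarrow> u n > 0"
  using U_pos by simp

lemma dirichlet_frequencies_U:
  assumes k: "k \<ge> 1"
  shows "dirichlet_frequencies (\<lambda>n. u (n + k))"
proof
  show "u (n + k) \<ge> 1" for n using U_pos[of "n + k"] k by simp
next
  fix \<sigma> :: real assume \<sigma>: "\<sigma> > 0"
  obtain c l where c: "c > 0" "l > 1" "\<And>n. n \<ge> 1 \<Longrightarrow> u n \<ge> c * l ^ n"
    using growth unfolding exponential_growth_def by blast
  let ?q = "l powr (- \<sigma>)"
  have q: "?q < 1" "?q > 0" using c \<sigma> by (auto simp: powr_minus_divide)
  show "summable (\<lambda>n. u (n + k) powr (- \<sigma>))"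
  proof (rule summable_comparison_test'[of _ 0])
    show "summable (\<lambda>n. c powr (- \<sigma>) * (?q ^ k * ?q ^ n))"
      using q by (intro summable_mult summable_geometric) auto
    fix n
    have "u (n + k) powr (- \<sigma>) \<le> (c * l ^ (n + k)) powr (- \<sigma>)"
      using c \<sigma> k by (intro powr_mono2') auto
    also have "\<dots> = c powr (- \<sigma>) * (l ^ (n + k)) powr (- \<sigma>)"
      using c by (intro powr_mult)
    also have "(l ^ (n + k)) powr (- \<sigma>) = ?q ^ (n + k)"
      using c q by (simp only: powr_powr mult.commute[of _ "- \<sigma>"] flip: powr_realpow)
    also have "c powr (- \<sigma>) * ?q ^ (n + k) = c powr (- \<sigma>) * (?q ^ k * ?q ^ n)"
      by (simp add: power_add mult.commute)
    finally show "norm (u (n + k) powr (- \<sigma>)) \<le> c powr (- \<sigma>) * (?q ^ k * ?q ^ n)" by simp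
  qed
qed

lemma summable_U: "k \<ge> 1 \<Longrightarrow> \<sigma> > 0 \<Longrightarrow> summable (\<lambda>n. u (n + k) powr (- \<sigma>))"
  using dirichlet_frequencies.summable_v[OF dirichlet_frequencies_U] .

lemma Z_eq:
  assumes "Re s > 0"
  shows "Z U s = (\<Sum>n. of_real (u (n + 1)) powr (- s))"
proof -
  interpret dirichlet_frequencies "\<lambda>n. u (n + 1)" by (rule dirichlet_frequencies_U) simp
  show ?thesis
    unfolding Z_def using summable_twisted[of "\<lambda>_. 1" 1 s] assms
    by (subst infsum_atLeast_eq_suminf) auto
qed

lemma R_tail_eq:
  assumes "\<sigma> > 0"
  shows "R_tail U N \<sigma> = (\<Sum>n. u (n + Suc N) powr (- \<sigma>))"
  unfolding R_tail_def atLeast_Suc_greaterThan[symmetric]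
  using summable_U[of "Suc N" \<sigma>] assms by (subst infsum_atLeast_eq_suminf) auto

lemma prime_dvd_U_in_prime_set:
  assumes "prime p" "p dvd U n" "n \<in> {1..N}"
  shows "p \<in> prime_set U N"
proof -
  have "U n dvd (\<Prod>n=1..N. U n)" using assms(3) by (intro dvd_prodI) auto
  with assms show ?thesis unfolding prime_set_def by (auto elim: dvd_trans)
qed

lemma C_eq: "C U N \<sigma> \<omega> = (\<Sum>n=1..N. of_real (u n powr (- \<sigma>)) * character \<omega> (U n))"
proof -
  have nz: "(\<Prod>n=1..N. U n) \<noteq> 0" using U_pos by (auto simp: prod_zero_iff) (metis less_irrefl)
  then have "prime_set U N = prime_factors (\<Prod>n=1..N. U n)"
    by (auto simp: prime_set_def in_prime_factors_iff)
  then have fin: "finite (prime_set U N)" by simp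
  have "prime_factors (U n) \<subseteq> prime_set U N" if "n \<in> {1..N}" for n
    using that by (auto intro: prime_dvd_U_in_prime_set)
  then show ?thesis
    unfolding C_def using fin
    by (intro sum.cong refl) (subst character_eq_prod[of "prime_set U N"], auto simp: prime_set_def)
qed

text \<open>The largest tail term sits at the same index for every \<open>\<sigma> > 0\<close>; this
  makes \<open>A_tail\<close> a single power and hence continuous.\<close>

definition U_min :: "nat \<Rightarrow> nat" where
  "U_min N = (ARG_MIN (\<lambda>n. nat (U n)) n. n > N)"

lemma U_min: "U_min N > N" "n > N \<Longrightarrow> U (U_min N) \<le> U n"
proof -
  show *: "U_min N > N" unfolding U_min_def by (rule arg_min_natI[of _ "Suc N"]) simp
  assume n: "n > N"
  have "nat (U (U_min N)) \<le> nat (U n)" unfolding U_min_def by (rule arg_min_nat_le) (rule n)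
  then show "U (U_min N) \<le> U n" using U_pos[of n] n by (simp add: nat_le_eq_zle)
qed

lemma A_tail_eq:
  assumes "\<sigma> > 0"
  shows "A_tail U N \<sigma> = u (U_min N) powr (- \<sigma>)"
proof (rule antisym)
  obtain n where n: "n > N" "A_tail U N \<sigma> = u n powr (- \<sigma>)"
    using A_tail_attained(1)[of U \<sigma> N] U_pos assms by auto
  show "A_tail U N \<sigma> \<le> u (U_min N) powr (- \<sigma>)"
    unfolding n(2) using U_min[of N] n(1) assms U_pos[of "U_min N"] by (intro powr_mono2') auto
  show "u (U_min N) powr (- \<sigma>) \<le> A_tail U N \<sigma>"
    using A_tail_attained(2)[of U \<sigma>] U_pos assms U_min(1) by auto
qed

lemma A_tail_le_R_tail:
  assumes "\<sigma> > 0"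
  shows "A_tail U N \<sigma> \<le> R_tail U N \<sigma>" "R_tail U N \<sigma> \<ge> 0"
proof -
  have s: "summable (\<lambda>n. u (n + Suc N) powr (- \<sigma>))" using summable_U[of "Suc N"] assms by simp
  have "(\<Sum>n\<in>{U_min N - Suc N}. u (n + Suc N) powr (- \<sigma>)) \<le> R_tail U N \<sigma>"
    unfolding R_tail_eq[OF assms] by (rule sum_le_suminf[OF s]) auto
  then show "A_tail U N \<sigma> \<le> R_tail U N \<sigma>"
    using U_min(1)[of N] by (simp add: A_tail_eq[OF assms])
  show "R_tail U N \<sigma> \<ge> 0" unfolding R_tail_eq[OF assms] by (rule suminf_nonneg[OF s]) simp
qed

lemma l_tail_le_R_tail: "\<sigma> > 0 \<Longrightarrow> l_tail U N \<sigma> \<le> R_tail U N \<sigma>"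
  using A_tail_le_R_tail[of \<sigma> N] by (simp add: l_tail_def)

lemma m_min_le_M_max: "m_min U N \<sigma> \<le> M_max U N \<sigma>"
  using m_min_attained M_max_attained by (metis order_trans)

lemma intervals_meet_iff:
  assumes "\<sigma> > 0"
  shows "{m_min U N \<sigma>..M_max U N \<sigma>} \<inter> {l_tail U N \<sigma>..R_tail U N \<sigma>} \<noteq> {} \<longleftrightarrow>
    m_min U N \<sigma> \<le> R_tail U N \<sigma> \<and> l_tail U N \<sigma> \<le> M_max U N \<sigma>"
  using m_min_le_M_max[of N \<sigma>] l_tail_le_R_tail[OF assms, of N] by (simp add: Int_atLeastAtMost) linarith

text \<open>With phases \<open>p ^ (- i Im \<rho>)\<close> the head \<open>C\<close> is exactly the
  sum of the first \<open>N\<close> terms of the series at \<open>\<rho>\<close>, so it is minus the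
  tail. The triangle inequality bounds the tail by \<open>R_tail\<close>, and isolating its largest
  term gives the lower bound.\<close>

lemma zero_imp_meet:
  assumes zero: "Z U \<rho> = 0" and re: "Re \<rho> > 0"
  shows "m_min U N (Re \<rho>) \<le> R_tail U N (Re \<rho>) \<and> l_tail U N (Re \<rho>) \<le> M_max U N (Re \<rho>)"
proof -
  define \<sigma> where "\<sigma> = Re \<rho>"
  define \<omega> where "\<omega> = (\<lambda>p\<in>prime_set U N. cis (- Im \<rho> * ln (real_of_int p)))"
  have \<omega>: "\<omega> \<in> torus U N" by (auto simp: \<omega>_def torus_def)
  interpret F: dirichlet_frequencies "\<lambda>n. u (n + 1)" by (rule dirichlet_frequencies_U) simp
  interpret G: dirichlet_frequencies "\<lambda>n. u (n + Suc N)" by (rule dirichlet_frequencies_U) simp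
  define f where "f n = complex_of_real (u (n + Suc N)) powr (- \<rho>)" for n
  define a where "a n = u (n + Suc N) powr (- \<sigma>)" for n
  have sum_a: "summable a" using summable_U[of "Suc N" \<sigma>] re by (simp add: \<sigma>_def a_def[abs_def])
  have fa: "norm (f n) = a n" for n using G.norm_v_powr by (simp only: \<sigma>_def f_def a_def)
  have sum_f: "summable f" using sum_a by (rule summable_norm_cancel[of f, unfolded fa])
  have "C U N \<sigma> \<omega> = (\<Sum>n=1..N. of_real (u n) powr (- \<rho>))"
    unfolding C_eq
  proof (intro sum.cong refl)
    fix n assume n: "n \<in> {1..N}"
    have "character \<omega> (U n) = character (\<lambda>p. cis (- Im \<rho> * ln (real_of_int p))) (U n)"
      using n by (intro character_cong) (simp add: \<omega>_def prime_dvd_U_in_prime_set)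
    also have "\<dots> = cis (- Im \<rho> * ln (u n))" using n U_pos[of n] by (intro character_cis) auto
    finally have "character \<omega> (U n) = cis (- Im \<rho> * ln (u n))" .
    moreover have "of_real (u n) powr (- \<rho>) = of_real (u n powr (- \<sigma>)) * cis (- Im \<rho> * ln (u n))"
    proof -
      have "- \<rho> * of_real (ln (u n)) = of_real (- \<sigma> * ln (u n)) + \<i> * of_real (- Im \<rho> * ln (u n))"
        by (simp add: complex_eq_iff \<sigma>_def)
      note e = this
      have un: "u n > 0" using u_pos[of n] n by simp
      then have "of_real (u n) powr (- \<rho>) = exp (- \<rho> * of_real (ln (u n)))"
        unfolding powr_def by (subst Ln_of_real) auto
      also have "\<dots> = of_real (exp (- \<sigma> * ln (u n))) * cis (- Im \<rho> * ln (u n))"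
        unfolding e exp_add exp_of_real cis_conv_exp ..
      also have "exp (- \<sigma> * ln (u n)) = u n powr (- \<sigma>)" using un by (simp add: powr_def)
      finally show ?thesis .
    qed
    ultimately show "of_real (u n powr (- \<sigma>)) * character \<omega> (U n) = of_real (u n) powr (- \<rho>)" by simp
  qed
  also have "\<dots> = (\<Sum>n<N. of_real (u (n + 1)) powr (- \<rho>))"
    by (simp add: sum.atLeast1_atMost_eq)
  finally have "Z U \<rho> = suminf f + C U N \<sigma> \<omega>"
    unfolding Z_eq[OF re]
    using suminf_split_initial_segment[OF summable_norm_cancel[OF F.summable_twisted[of "\<lambda>_. 1" 1 \<rho>]], of N] re
    by (simp add: f_def[abs_def] add_ac)
  then have C: "C U N \<sigma> \<omega> = - suminf f" using zero by (simp add: add_eq_0_iff)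
  have R: "R_tail U N \<sigma> = suminf a" using re by (simp add: R_tail_eq \<sigma>_def a_def[abs_def])
  have "norm (suminf f) \<le> suminf a" using fa sum_a by (intro norm_suminf_le) auto
  then have up: "norm (C U N \<sigma> \<omega>) \<le> R_tail U N \<sigma>" by (simp add: C R)
  define j where "j = U_min N - Suc N"
  have Aj: "A_tail U N \<sigma> = a j" using re U_min(1)[of N] by (simp add: A_tail_eq \<sigma>_def j_def a_def)
  \<comment> \<open>The tail without its largest term has modulus at most
    \<open>R_tail - A_tail\<close>.\<close>
  have f': "(\<lambda>n. f n - (if n = j then f n else 0)) sums (suminf f - f j)"
    by (intro sums_diff summable_sums sum_f sums_single)
  have a': "(\<lambda>n. a n - (if n = j then a n else 0)) sums (suminf a - a j)"
    by (intro sums_diff summable_sums sum_a sums_single)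
  have "norm (\<Sum>n. f n - (if n = j then f n else 0)) \<le> (\<Sum>n. a n - (if n = j then a n else 0))"
    using sums_summable[OF a'] by (intro norm_suminf_le) (auto simp: fa)
  then have "norm (suminf f - f j) \<le> suminf a - a j"
    unfolding sums_unique[OF f', symmetric] sums_unique[OF a', symmetric] .
  moreover have "norm (f j) \<le> norm (suminf f) + norm (suminf f - f j)"
    using norm_triangle_sub[of "f j" "suminf f"] norm_minus_commute[of "f j" "suminf f"] by simp
  ultimately have "2 * A_tail U N \<sigma> - R_tail U N \<sigma> \<le> norm (C U N \<sigma> \<omega>)" by (simp add: C Aj R fa)
  then have low: "l_tail U N \<sigma> \<le> norm (C U N \<sigma> \<omega>)" by (simp add: l_tail_def)
  show ?thesis
    using up low m_min_attained(2)[OF \<omega>, of \<sigma>] M_max_attained(2)[OF \<omega>, of \<sigma>]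
    unfolding \<sigma>_def by linarith
qed

section \<open>Continuity in \<open>\<sigma>\<close> of the tail data and of the torus
  extrema\<close>

lemma continuous_R_tail: "continuous_on {0<..} (R_tail U N)"
proof -
  interpret dirichlet_frequencies "\<lambda>n. u (n + Suc N)" by (rule dirichlet_frequencies_U) simp
  have "continuous_on {s. Re s > 0} (twisted (\<lambda>_. 1))"
    using twisted_holomorphic[of "\<lambda>_. 1"] by (intro holomorphic_on_imp_continuous_on) auto
  then have "continuous_on {0<..} (\<lambda>\<sigma>. Re (twisted (\<lambda>_. 1) (complex_of_real \<sigma>)))"
    by (intro continuous_intros continuous_on_compose2[where f = of_real and g = "twisted (\<lambda>_. 1)"]) auto
  moreover have "Re (twisted (\<lambda>_. 1) (complex_of_real \<sigma>)) = R_tail U N \<sigma>" if "\<sigma> > 0" for \<sigma>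
  proof -
    have "twisted (\<lambda>_. 1) (complex_of_real \<sigma>) = (\<Sum>n. of_real (u (n + Suc N) powr (- \<sigma>)))"
      unfolding twisted_def
    proof (intro suminf_cong)
      fix n
      show "1 * complex_of_real (u (n + Suc N)) powr (- of_real \<sigma>) = of_real (u (n + Suc N) powr (- \<sigma>))"
        using powr_of_real[of "u (n + Suc N)" "- \<sigma>"] v_pos[of n] by simp
    qed
    also have "\<dots> = of_real (R_tail U N \<sigma>)"
      using summable_U[of "Suc N" \<sigma>] that by (simp add: R_tail_eq suminf_of_real)
    finally show ?thesis by simp
  qed
  ultimately show ?thesis by (rule continuous_on_eq) simp
qed

lemma continuous_l_tail: "continuous_on {0<..} (l_tail U N)"
proof -
  have "continuous_on {0<..} (\<lambda>\<sigma>. u (U_min N) powr (- \<sigma>))"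
    using u_pos[of "U_min N"] U_min(1)[of N] by (intro continuous_intros) auto
  then have "continuous_on {0<..} (A_tail U N)"
    by (rule continuous_on_eq) (simp add: A_tail_eq)
  then show ?thesis unfolding l_tail_def[abs_def]
    by (intro continuous_intros continuous_R_tail)
qed

lemma norm_C_diff_le:
  assumes "\<omega> \<in> torus U N"
  shows "\<bar>norm (C U N \<sigma> \<omega>) - norm (C U N \<tau> \<omega>)\<bar> \<le> (\<Sum>n=1..N. \<bar>u n powr (- \<sigma>) - u n powr (- \<tau>)\<bar>)"
proof -
  have char: "norm (character \<omega> (U n)) = 1" if "n \<in> {1..N}" for n
  proof -
    have "character \<omega> (U n) = character (\<lambda>p. if p \<in> prime_set U N then \<omega> p else 1) (U n)"
      using prime_dvd_U_in_prime_set[OF _ _ that] by (intro character_cong) simp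
    moreover have "norm (if p \<in> prime_set U N then \<omega> p else 1) = 1" for p
      using PiE_mem[OF assms[unfolded torus_def], of p] by simp
    ultimately show ?thesis using norm_character[of "\<lambda>p. if p \<in> prime_set U N then \<omega> p else 1"] by simp
  qed
  have "\<bar>norm (C U N \<sigma> \<omega>) - norm (C U N \<tau> \<omega>)\<bar> \<le> norm (C U N \<sigma> \<omega> - C U N \<tau> \<omega>)"
    by (rule norm_triangle_ineq3)
  also have "C U N \<sigma> \<omega> - C U N \<tau> \<omega> =
      (\<Sum>n=1..N. of_real (u n powr (- \<sigma>) - u n powr (- \<tau>)) * character \<omega> (U n))"
    by (simp add: C_eq sum_subtractf left_diff_distrib)
  also have "norm \<dots> \<le> (\<Sum>n=1..N. \<bar>u n powr (- \<sigma>) - u n powr (- \<tau>)\<bar>)"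
    by (rule sum_norm_le) (simp add: norm_mult char flip: of_real_diff)
  finally show ?thesis .
qed

text \<open>The bound in \<open>norm_C_diff_le\<close> does not depend on \<open>\<omega>\<close>. A
  point extremal for one parameter is a competitor for the other, so the extrema inherit the same
  bound.\<close>

lemma continuous_extrema:
  "continuous_on {0<..} (m_min U N)" "continuous_on {0<..} (M_max U N)"
proof -
  let ?D = "\<lambda>\<sigma> \<tau>. \<Sum>n=1..N. \<bar>u n powr (- \<sigma>) - u n powr (- \<tau>)\<bar>"
  have m: "m_min U N \<sigma> \<le> m_min U N \<tau> + ?D \<sigma> \<tau>" for \<sigma> \<tau>
  proof -
    obtain \<omega> where "\<omega> \<in> torus U N" "m_min U N \<tau> = norm (C U N \<tau> \<omega>)" using m_min_attained(1) by blast
    with m_min_attained(2)[of \<omega> U N \<sigma>] norm_C_diff_le[of \<omega> N \<sigma> \<tau>] show ?thesis by linarith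
  qed
  have M: "M_max U N \<sigma> \<le> M_max U N \<tau> + ?D \<sigma> \<tau>" for \<sigma> \<tau>
  proof -
    obtain \<omega> where "\<omega> \<in> torus U N" "M_max U N \<sigma> = norm (C U N \<sigma> \<omega>)" using M_max_attained(1) by blast
    with M_max_attained(2)[of \<omega> U N \<tau>] norm_C_diff_le[of \<omega> N \<sigma> \<tau>] show ?thesis by linarith
  qed
  have sym: "?D \<sigma> \<tau> = ?D \<tau> \<sigma>" for \<sigma> \<tau> by (simp add: abs_minus_commute)
  have lim: "((\<lambda>\<sigma>. ?D \<sigma> \<tau>) \<longlongrightarrow> 0) (at \<tau> within {0<..})" for \<tau>
  proof -
    have "((\<lambda>\<sigma>. u n powr (- \<sigma>) - u n powr (- \<tau>)) \<longlongrightarrow> u n powr (- \<tau>) - u n powr (- \<tau>)) (at \<tau> within {0<..})"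
      if "n \<in> {1..N}" for n
      using u_pos[of n] that by (intro tendsto_intros) auto
    then have "((\<lambda>\<sigma>. ?D \<sigma> \<tau>) \<longlongrightarrow> (\<Sum>n=1..N. \<bar>u n powr (- \<tau>) - u n powr (- \<tau>)\<bar>)) (at \<tau> within {0<..})"
      by (intro tendsto_sum tendsto_rabs) auto
    then show ?thesis by simp
  qed
  have cont: "continuous_on {0<..} f" if f: "\<And>\<sigma> \<tau>. f \<sigma> \<le> f \<tau> + ?D \<sigma> \<tau>" for f :: "real \<Rightarrow> real"
    unfolding continuous_on_def
  proof (intro ballI, rule LIM_zero_cancel, rule Lim_null_comparison[OF always_eventually lim], rule allI)
    fix \<tau> \<sigma>
    show "norm (f \<sigma> - f \<tau>) \<le> ?D \<sigma> \<tau>" using f[of \<sigma> \<tau>] f[of \<tau> \<sigma>] sym[of \<sigma> \<tau>] by simp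
  qed
  show "continuous_on {0<..} (m_min U N)" "continuous_on {0<..} (M_max U N)"
    using m M by (blast intro: cont)+
qed

lemma closure_imp_meet:
  assumes \<sigma>: "\<sigma> \<in> closure (zero_real_parts U)" "\<sigma> > 0"
  shows "m_min U N \<sigma> \<le> R_tail U N \<sigma> \<and> l_tail U N \<sigma> \<le> M_max U N \<sigma>"
proof -
  obtain x where x: "\<And>n. x n \<in> zero_real_parts U" "x \<longlonglongrightarrow> \<sigma>"
    using \<sigma>(1) unfolding closure_sequential by blast
  have x0: "x n > 0" and meet: "m_min U N (x n) \<le> R_tail U N (x n)" "l_tail U N (x n) \<le> M_max U N (x n)" for n
  proof -
    obtain \<rho> where "x n = Re \<rho>" "Z U \<rho> = 0" "Re \<rho> > 0" using x(1)[of n] unfolding zero_real_parts_def by blast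
    then show "x n > 0" "m_min U N (x n) \<le> R_tail U N (x n)" "l_tail U N (x n) \<le> M_max U N (x n)"
      using zero_imp_meet[of \<rho> N] by simp_all
  qed
  have lim: "(\<lambda>n. f (x n)) \<longlonglongrightarrow> f \<sigma>" if "continuous_on {0<..} f" for f :: "real \<Rightarrow> real"
    using continuous_on_tendsto_compose[OF that x(2)] \<sigma>(2) x0 by simp
  show ?thesis
    using LIMSEQ_le[OF lim lim] meet continuous_extrema continuous_R_tail continuous_l_tail by blast
qed

text \<open>The phase of \<open>U n\<close> is adjusted at its primitive prime, which leaves the earlier phases alone.\<close>

lemma independent_tail_phases:
  assumes prim: "\<forall>n>N. has_primitive_prime_divisor U n"
    and \<omega>: "\<And>p. prime p \<Longrightarrow> norm (\<omega> p) = 1" and e: "\<And>n. norm (e n) = 1"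
  shows "\<exists>\<omega>'. (\<forall>p. prime p \<longrightarrow> norm (\<omega>' p) = 1) \<and>
    (\<forall>n\<in>{1..K}. character \<omega>' (U n) = (if n \<le> N then character \<omega> (U n) else e n))"
proof (induction K)
  case (Suc K)
  then obtain \<omega>' where \<omega>': "\<And>p. prime p \<Longrightarrow> norm (\<omega>' p) = 1"
    "\<And>n. n \<in> {1..K} \<Longrightarrow> character \<omega>' (U n) = (if n \<le> N then character \<omega> (U n) else e n)" by blast
  show ?case
  proof (cases "Suc K \<le> N")
    case True
    then show ?thesis using \<omega> by (intro exI[of _ \<omega>]) auto
  next
    case False
    then obtain p where p: "prime p" "p dvd U (Suc K)" "\<And>j. 1 \<le> j \<Longrightarrow> j < Suc K \<Longrightarrow> \<not> p dvd U j"
      using prim unfolding has_primitive_prime_divisor_def by (meson not_le)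
    have "U (Suc K) \<noteq> 0" using U_pos[of "Suc K"] by simp
    then obtain y where y: "norm y = 1" "character (fun_upd \<omega>' p y) (U (Suc K)) = e (Suc K)"
      using character_update[of p "U (Suc K)" \<omega>' "e (Suc K)"] p(1,2) \<omega>'(1) e by blast
    have "character (fun_upd \<omega>' p y) (U n) = character \<omega>' (U n)" if "n \<in> {1..K}" for n
      using p(3)[of n] that by (intro character_cong) auto
    then have "\<forall>n\<in>{1..Suc K}. character (fun_upd \<omega>' p y) (U n) = (if n \<le> N then character \<omega> (U n) else e n)"
      using y(2) \<omega>'(2) False by (auto simp: le_Suc_eq)
    moreover have "\<forall>q. prime q \<longrightarrow> norm (fun_upd \<omega>' p y q) = 1" using \<omega>'(1) y(1) by simp
    ultimately show ?thesis by blast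
  qed
qed (use \<omega> in auto)

lemma meet_imp_closure:
  assumes prim: "\<forall>n>N. has_primitive_prime_divisor U n" and \<sigma>: "\<sigma> > 0"
    and meet: "{m_min U N \<sigma>..M_max U N \<sigma>} \<inter> {l_tail U N \<sigma>..R_tail U N \<sigma>} \<noteq> {}"
  shows "\<sigma> \<in> closure (zero_real_parts U)"
proof -
  interpret F: dirichlet_frequencies "\<lambda>n. u (n + 1)" by (rule dirichlet_frequencies_U) simp
  obtain r where r: "m_min U N \<sigma> \<le> r" "r \<le> M_max U N \<sigma>" "l_tail U N \<sigma> \<le> r" "r \<le> R_tail U N \<sigma>"
  proof -
    from meet obtain r where "r \<in> {m_min U N \<sigma>..M_max U N \<sigma>} \<inter> {l_tail U N \<sigma>..R_tail U N \<sigma>}" by blast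
    then show thesis by (intro that[of r]) simp_all
  qed
  obtain \<omega>0 where \<omega>0: "\<omega>0 \<in> torus U N" "norm (C U N \<sigma> \<omega>0) = r" using norm_C_intermediate[OF r(1,2)] .
  \<comment> \<open>Kronecker's theorem is applied to phases at all primes; off the head they start
    as 1.\<close>
  define \<omega> where "\<omega> p = (if p \<in> prime_set U N then \<omega>0 p else 1)" for p
  have \<omega>: "norm (\<omega> p) = 1" for p
    using PiE_mem[OF \<omega>0(1)[unfolded torus_def], of p] by (simp add: \<omega>_def)
  have C\<omega>: "C U N \<sigma> \<omega> = C U N \<sigma> \<omega>0"
    unfolding C_def by (intro sum.cong refl arg_cong2[where f = "(*)"] prod.cong) (simp add: \<omega>_def)
  let ?a = "\<lambda>n. u (n + Suc N) powr (- \<sigma>)"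
  obtain e where e: "\<And>n. norm (e n) = 1" "C U N \<sigma> \<omega> + (\<Sum>n. e n * of_real (?a n)) = 0"
  proof (rule infinite_polygon[of ?a "C U N \<sigma> \<omega>"])
    show "summable ?a" using summable_U[of "Suc N"] \<sigma> by simp
    show "norm (C U N \<sigma> \<omega>) \<le> suminf ?a" using r \<omega>0 \<sigma> by (simp add: C\<omega> R_tail_eq)
    show "2 * ?a n - suminf ?a \<le> norm (C U N \<sigma> \<omega>)" for n
    proof -
      have "?a n \<le> A_tail U N \<sigma>"
        using A_tail_attained(2)[of U \<sigma> N "n + Suc N"] U_pos \<sigma> by simp
      then show ?thesis using r \<omega>0 \<sigma> by (simp add: C\<omega> R_tail_eq l_tail_def)
    qed
  qed (simp, blast)
  \<comment> \<open>Polygon side 0 belongs to the term \<open>N + 1\<close>, hence the shift by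
    \<open>Suc N\<close>.\<close>
  define g where "g n = (if n \<le> N then character \<omega> (U n) else e (n - Suc N))" for n
  have g1: "norm (g n) = 1" for n using e(1) norm_character[of \<omega>, OF \<omega>] by (simp add: g_def)
  have gone: "g n = 1" if "n \<ge> 1" "u n = 1" for n
  proof -
    have U1: "U n = 1" using that by simp
    have "n \<le> N"
    proof (rule ccontr)
      assume "\<not> n \<le> N"
      then obtain p where "prime p" "p dvd U n" using prim unfolding has_primitive_prime_divisor_def by (meson not_le)
      then show False using U1 by (simp add: not_prime_unit)
    qed
    then show ?thesis using U1 by (simp add: g_def character_def)
  qed
  have "\<exists>t. \<forall>n\<in>{1..K}. norm (cis (- t * ln (u n)) - g n) < inverse (real (Suc K))" for K
  proof -
    obtain \<omega>' where \<omega>': "\<And>p. prime p \<Longrightarrow> norm (\<omega>' p) = 1" "\<And>n. n \<in> {1..K} \<Longrightarrow> character \<omega>' (U n) = g n"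
      using independent_tail_phases[OF prim, of \<omega> "\<lambda>n. e (n - Suc N)" K] \<omega> e(1) unfolding g_def by blast
    have fin: "finite (U ` {1..K})" and pos: "inverse (real (Suc K)) > 0" by simp_all
    have U: "m > 0" if "m \<in> U ` {1..K}" for m using that U_pos by force
    obtain t where t: "\<And>m. m \<in> U ` {1..K} \<Longrightarrow>
        norm (cis (t * ln (real_of_int m)) - character \<omega>' m) < inverse (real (Suc K))"
      using kronecker_character[of "U ` {1..K}" \<omega>' "inverse (real (Suc K))", OF fin U \<omega>'(1) pos] by blast
    show ?thesis
    \<comment> \<open>The limit in \<open>zero_of_translates\<close> is stated for phases
      \<open>- t\<close>, so the time changes sign.\<close>
    proof (intro exI[of _ "- t"] ballI)
      fix n assume n: "n \<in> {1..K}"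
      then have "U n \<in> U ` {1..K}" by (rule imageI)
      from t[OF this] show "norm (cis (- (- t) * ln (u n)) - g n) < inverse (real (Suc K))"
        by (simp only: \<omega>'(2)[OF n] minus_minus)
    qed
  qed
  then have "\<exists>t. \<forall>K. \<forall>n\<in>{1..K}. norm (cis (- t K * ln (u n)) - g n) < inverse (real (Suc K))"
    by (intro choice allI)
  then obtain t where t: "norm (cis (- t K * ln (u n)) - g n) < inverse (real (Suc K))" if "n \<in> {1..K}" for K n
    by blast
  have lim: "(\<lambda>K. cis (- t K * ln (u n))) \<longlonglongrightarrow> g n" if "n \<ge> 1" for n
  proof (rule LIM_zero_cancel, rule Lim_null_comparison)
    show "\<forall>\<^sub>F K in sequentially. norm (cis (- t K * ln (u n)) - g n) \<le> inverse (real (Suc K))"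
      using eventually_ge_at_top[of n] by eventually_elim (use t that in \<open>auto intro!: less_imp_le\<close>)
  qed (rule LIMSEQ_inverse_real_of_nat)
  have zero: "F.twisted (\<lambda>n. g (n + 1)) (of_real \<sigma>) = 0"
  proof -
    have powr: "of_real (u n) powr (- complex_of_real \<sigma>) = of_real (u n powr (- \<sigma>))" if "n \<ge> 1" for n
      using powr_of_real[of "u n" "- \<sigma>"] u_pos[OF that] by simp
    let ?h = "\<lambda>n. g (n + 1) * of_real (u (n + 1)) powr (- complex_of_real \<sigma>)"
    have h: "?h n = g (n + 1) * of_real (u (n + 1) powr (- \<sigma>))" for n
      by (simp only: powr[OF le_add2])
    have "summable ?h"
      by (rule summable_norm_cancel, rule F.summable_twisted[of _ 1]) (use g1 \<sigma> in auto)
    then have "suminf ?h = (\<Sum>n. ?h (n + N)) + (\<Sum>n<N. ?h n)" by (rule suminf_split_initial_segment)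
    also have "(\<Sum>n<N. ?h n) = C U N \<sigma> \<omega>"
      unfolding h unfolding C_eq One_nat_def sum.atLeast1_atMost_eq by (intro sum.cong) (simp_all add: g_def mult.commute)
    also have "(\<Sum>n. ?h (n + N)) = (\<Sum>n. e n * of_real (?a n))"
      unfolding h by (intro suminf_cong) (simp add: g_def)
    also have "(\<Sum>n. e n * of_real (?a n)) + C U N \<sigma> \<omega> = 0" using e(2) by (subst add.commute)
    finally show ?thesis unfolding F.twisted_def .
  qed
  have "\<exists>y\<in>zero_real_parts U. dist y \<sigma> < d" if d: "d > 0" for d
  proof -
    have "\<exists>\<rho>. Re \<rho> > 0 \<and> \<bar>Re \<rho> - \<sigma>\<bar> < d \<and> F.twisted (\<lambda>_. 1) \<rho> = 0"
    proof (rule F.zero_of_translates[of "\<lambda>n. g (n + 1)" t])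
      show "u (0 + 1) = 1" by (simp add: U_1)
      show "u (n + 1) = 1 \<Longrightarrow> g (n + 1) = 1" for n using gone by simp
    qed (use g1 lim zero \<sigma> d in auto)
    then obtain \<rho> where \<rho>: "Re \<rho> > 0" "\<bar>Re \<rho> - \<sigma>\<bar> < d" "F.twisted (\<lambda>_. 1) \<rho> = 0" by blast
    have "Z U \<rho> = 0" using \<rho>(3) unfolding Z_eq[OF \<rho>(1)] F.twisted_def by simp
    with \<rho> show ?thesis unfolding zero_real_parts_def by (intro bexI[of _ "Re \<rho>"]) (auto simp: dist_real_def)
  qed
  then show ?thesis by (simp add: closure_approachable)
qed

lemma closure_zero_real_parts:
  assumes "\<forall>n>N. has_primitive_prime_divisor U n"
  shows "closure (zero_real_parts U) \<inter> {0<..} =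
    {\<sigma>. \<sigma> > 0 \<and> {m_min U N \<sigma>..M_max U N \<sigma>} \<inter> {l_tail U N \<sigma>..R_tail U N \<sigma>} \<noteq> {}}"
proof (intro set_eqI iffI)
  fix \<sigma> assume "\<sigma> \<in> closure (zero_real_parts U) \<inter> {0<..}"
  then have \<sigma>: "\<sigma> \<in> closure (zero_real_parts U)" "\<sigma> > 0" by simp_all
  from closure_imp_meet[OF this, of N] show
    "\<sigma> \<in> {\<sigma>. \<sigma> > 0 \<and> {m_min U N \<sigma>..M_max U N \<sigma>} \<inter> {l_tail U N \<sigma>..R_tail U N \<sigma>} \<noteq> {}}"
    unfolding mem_Collect_eq intervals_meet_iff[OF \<sigma>(2)] using \<sigma>(2) by blast
qed (use meet_imp_closure[OF assms] in blast)

end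


theorem theorem5p1:
  fixes P Q :: int and U :: "nat \<Rightarrow> int"
  assumes "coprime P Q"
    and "P ^ 2 - 4 * Q > 0"
    and "U 0 = 0" and "U 1 = 1"
    and "\<forall>n. U (n + 2) = P * U (n + 1) - Q * U n"
    and "nondegenerate P Q"
    and "\<forall>n\<ge>1. U n > 0"
    and "exponential_growth U"
  shows
    "(\<forall>N. (\<forall>n>N. has_primitive_prime_divisor U n) \<longrightarrow>
        closure (zero_real_parts U) \<inter> {0<..} =
          {\<sigma>. \<sigma> > 0 \<and> {m_min U N \<sigma>..M_max U N \<sigma>} \<inter> {l_tail U N \<sigma>..R_tail U N \<sigma>} \<noteq> {}}
        \<and> (\<forall>\<sigma>>0. {m_min U N \<sigma>..M_max U N \<sigma>} \<inter> {l_tail U N \<sigma>..R_tail U N \<sigma>} \<noteq> {} \<longleftrightarrow>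
                   m_min U N \<sigma> \<le> R_tail U N \<sigma> \<and> l_tail U N \<sigma> \<le> M_max U N \<sigma>))
     \<and> closure (zero_real_parts U) \<inter> {0<..} =
          {\<sigma>. \<sigma> > 0 \<and> {m_min U 30 \<sigma>..M_max U 30 \<sigma>} \<inter> {l_tail U 30 \<sigma>..R_tail U 30 \<sigma>} \<noteq> {}}"
proof -
  interpret growing_lucas P Q U
  proof
    show "U (Suc (Suc n)) = P * U (Suc n) - Q * U n" for n
      using assms(5) by (simp add: numeral_2_eq_2)
  qed (use assms(1,3,4,7,8) in simp_all)
  have "Q \<noteq> 0" using assms(6) by (simp add: nondegenerate_def)
  then have "\<forall>n>30. has_primitive_prime_divisor U n" using carmichael assms(2) by blast
  then show ?thesis
    using closure_zero_real_parts intervals_meet_iff by blast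
qed

end
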